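(* Suppose $(\gamma_n)_{n\ge1}$ is a sequence such that for all $f,g\in C^1(\mathbb T^2,\mathbb R)$ and all $n\ge 1$ $$\left|\int_{\mathbb T^2}(f\circ T^{-n})\, g\,dm-\int_{\mathbb T^2}f\,dm\int_{\mathbb T^2}g\,dm\right| \le \left(\|\partial^u f\|_{L^1(\nu)}+\|f\|_{L^1(\nu)}\right)\|g\|_{C^1}\,\gamma_n .$$ Then there exists a constant $C>0$ such that $\gamma_n\ge C\,n^{-2}$ for all $n\ge 1$.
   Context: Let $\mathbb T^1=\mathbb R/\mathbb Z$, $\mathbb T^2=\mathbb T^1\times\mathbb T^1$ (coordinates represented in $(-1/2,1/2]$), and let $m$ be Lebesgue measure on $\mathbb T^2$. Let $h\in C^\infty(\mathbb T^1,\mathbb T^1)$ satisfy: (1) $h(0)=0$; (2) $h'(0)=0$; (3) $h'(x)>0$ for each $x\ne 0$; (4) $h'''(0)>0$; (5) $h(-x)=-h(x)$. Define $T:\mathbb T^2\to\mathbb T^2$ by $T(x,y)=(x+h(x)+y,\ h(x)+y) \bmod 1$, an $m$-preserving diffeomorphism. At $m$-a.e. point $T$ has one positive and one negative Lyapunov exponent; the unstable direction $E^u$ (Oseledets subspace of the positive exponent) extends to a continuous line field on $\mathbb T^2$, and $\partial^u f$ denotes the derivative of $f$ along the unit vector field tangent to $E^u$. For $\rho>0$ let $D_\rho=\{(z_1,z_2)\in\mathbb T^2: |z_1|\le\rho,\ |z_2|\le\rho^2\}$. The measure $\nu$ is defined by $\nu(\phi)=\int_0^1 d\rho\int_{\partial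 D_\rho}\phi$, the inner integral being with respect to arc length on the boundary $\partial D_\rho$ (in $\mathbb T^2$). *)

theory Defs
  imports "HOL-Analysis.Analysis"
begin

text \<open>
  The torus \<open>\<real>\<^sup>2/\<int>\<^sup>2\<close> is handled through its universal cover: functions and
  fields on the torus are \<open>\<int>\<^sup>2\<close>-periodic functions on \<open>real \<times> real\<close>, maps of the torus
  are lifts to \<open>real \<times> real\<close>, and the points of the torus are represented
  in the cell \<open>(-1/2, 1/2]\<^sup>2\<close>.
\<close>

definition torus_fun :: "(real \<times> real \<Rightarrow> 'a) \<Rightarrow> bool" where
  "torus_fun f \<longleftrightarrow> (\<forall>x y. f (x + 1, y) = f (x, y) \<and> f (x, y + 1) = f (x, y))"

definition torus_cell :: "(real \<times> real) set" where
  "torus_cell = {-1/2<..1/2} \<times> {-1/2<..1/2}"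

definition torus_measure :: "(real \<times> real) measure" where
  "torus_measure = restrict_space lborel torus_cell"

text \<open>
  \<open>h\<close> is a lift of a smooth circle map satisfying (1)--(5). Equalities in the circle are
  equalities modulo \<open>\<int>\<close>, and \<open>x \<notin> \<int>\<close> says that \<open>x\<close> is not the point 0 of the circle.
  The degree of the circle map is not prescribed.
\<close>

definition circle_map_lift :: "(real \<Rightarrow> real) \<Rightarrow> bool" where
  "circle_map_lift h \<longleftrightarrow>
     (\<forall>k x. (deriv ^^ k) h differentiable (at x)) \<and>
     (\<forall>x. h (x + 1) - h x \<in> \<int>) \<and>
     h 0 \<in> \<int> \<and>
     deriv h 0 = 0 \<and>
     (\<forall>x. x \<notin> \<int> \<longrightarrow> deriv h x > 0) \<and>
     (deriv ^^ 3) h 0 > 0 \<and>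
     (\<forall>x. h (- x) + h x \<in> \<int>)"

definition T_lift :: "(real \<Rightarrow> real) \<Rightarrow> real \<times> real \<Rightarrow> real \<times> real" where
  "T_lift h = (\<lambda>(x, y). (x + h x + y, h x + y))"

lemma T_lift_inverse:
  "T_lift h (u - v, v - h (u - v)) = (u, v)"
  by (simp add: T_lift_def)

lemma bij_T_lift: "bij (T_lift h)"
proof (rule bijI)
  show "inj (T_lift h)"
  proof (rule injI)
    fix p q assume eq: "T_lift h p = T_lift h q"
    then have "fst p = fst q" by (auto simp: T_lift_def split: prod.splits)
    with eq show "p = q" by (auto simp: T_lift_def split: prod.splits)
  qed
  show "surj (T_lift h)"
    by (rule surjI[of _ "\<lambda>z. (fst z - snd z, snd z - h (fst z - snd z))"]) (simp add: T_lift_inverse)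
qed

definition T_pow :: "(real \<Rightarrow> real) \<Rightarrow> int \<Rightarrow> real \<times> real \<Rightarrow> real \<times> real" where
  "T_pow h k = (if 0 \<le> k then T_lift h ^^ nat k else inv (T_lift h) ^^ nat (- k))"

text \<open>
  The Oseledets subspace of the invertible map \<open>T\<close> at \<open>z\<close> for the value \<open>lam\<close>: besides 0 it
  contains the vectors whose growth rate \<open>(1/n) ln \<parallel>D\<^sub>zT\<^sup>n v\<parallel>\<close> tends to \<open>lam\<close> both for
  \<open>n \<rightarrow> \<infinity>\<close> and for \<open>n \<rightarrow> -\<infinity>\<close>. It is \<open>{0}\<close> if \<open>lam\<close> is not a Lyapunov exponent at \<open>z\<close>.
\<close>

definition growth_rate ::
  "(real \<Rightarrow> real) \<Rightarrow> real \<times> real \<Rightarrow> real \<times> real \<Rightarrow> int \<Rightarrow> real" where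
  "growth_rate h z v k = ln (norm (frechet_derivative (T_pow h k) (at z) v)) / real_of_int k"

definition oseledets_subspace ::
  "(real \<Rightarrow> real) \<Rightarrow> real \<Rightarrow> real \<times> real \<Rightarrow> (real \<times> real) set" where
  "oseledets_subspace h lam z =
     {v. v = 0 \<or> (growth_rate h z v \<longlongrightarrow> lam) at_top \<and> (growth_rate h z v \<longlongrightarrow> lam) at_bot}"

definition continuous_line_field :: "(real \<times> real \<Rightarrow> (real \<times> real) set) \<Rightarrow> bool" where
  "continuous_line_field E \<longleftrightarrow>
     (\<forall>z. \<exists>U w. open U \<and> z \<in> U \<and> continuous_on U w \<and>
        (\<forall>x\<in>U. w x \<noteq> 0 \<and> E x = span {w x}))"

text \<open>
  \<open>E\<close> is the continuous extension of the unstable direction. There is at most one such \<open>E\<close>,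
  as continuous line fields that agree almost everywhere are equal.
\<close>

definition unstable_line_field ::
  "(real \<Rightarrow> real) \<Rightarrow> (real \<times> real \<Rightarrow> (real \<times> real) set) \<Rightarrow> bool" where
  "unstable_line_field h E \<longleftrightarrow>
     torus_fun E \<and> continuous_line_field E \<and>
     (AE z in torus_measure. \<exists>lam>0. E z = oseledets_subspace h lam z)"

definition unit_tangent_field ::
  "(real \<times> real \<Rightarrow> (real \<times> real) set) \<Rightarrow> (real \<times> real \<Rightarrow> real \<times> real) \<Rightarrow> bool" where
  "unit_tangent_field E e \<longleftrightarrow> torus_fun e \<and> (\<forall>z. norm (e z) = 1 \<and> e z \<in> E z)"

definition deriv_along ::
  "(real \<times> real \<Rightarrow> real \<times> real) \<Rightarrow> (real \<times> real \<Rightarrow> real) \<Rightarrow> real \<times> real \<Rightarrow> real" where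
  "deriv_along e f z = frechet_derivative f (at z) (e z)"

definition C1_torus :: "(real \<times> real \<Rightarrow> real) \<Rightarrow> bool" where
  "C1_torus f \<longleftrightarrow> torus_fun f \<and>
     (\<exists>f'. (\<forall>z. (f has_derivative blinfun_apply (f' z)) (at z)) \<and> continuous_on UNIV f')"

definition C1_norm :: "(real \<times> real \<Rightarrow> real) \<Rightarrow> real" where
  "C1_norm g = (SUP z. \<bar>g z\<bar>) + (SUP z. onorm (frechet_derivative g (at z)))"

definition D_set :: "real \<Rightarrow> (real \<times> real) set" where
  "D_set \<rho> = {z \<in> torus_cell. \<bar>fst z\<bar> \<le> \<rho> \<and> \<bar>snd z\<bar> \<le> \<rho>\<^sup>2}"

definition torus_preimage :: "(real \<times> real) set \<Rightarrow> (real \<times> real) set" where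
  "torus_preimage A = {(x, y). \<exists>i j :: int. (x + of_int i, y + of_int j) \<in> A}"

text \<open>
  The boundary of \<open>D_set \<rho>\<close> in the torus, as a list of segments. For \<open>\<rho> < 1/2\<close> it consists of
  the sides of the rectangle; for \<open>\<rho> \<ge> 1/2\<close> and \<open>\<rho>\<^sup>2 < 1/2\<close> the set is an annulus around the
  torus and its boundary consists of two circles; afterwards the set is the whole torus.
  Lemma \<open>frontier_D_set\<close> shows that this is the topological boundary.
\<close>

definition D_boundary :: "real \<Rightarrow> (real \<Rightarrow> real \<times> real) list" where
  "D_boundary \<rho> =
     (if \<rho> < 1/2 then
        [linepath (-\<rho>, -\<rho>\<^sup>2) (\<rho>, -\<rho>\<^sup>2), linepath (\<rho>, -\<rho>\<^sup>2) (\<rho>, \<rho>\<^sup>2),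
         linepath (\<rho>, \<rho>\<^sup>2) (-\<rho>, \<rho>\<^sup>2), linepath (-\<rho>, \<rho>\<^sup>2) (-\<rho>, -\<rho>\<^sup>2)]
      else if \<rho>\<^sup>2 < 1/2 then
        [linepath (-1/2, -\<rho>\<^sup>2) (1/2, -\<rho>\<^sup>2), linepath (1/2, \<rho>\<^sup>2) (-1/2, \<rho>\<^sup>2)]
      else [])"

definition arc_length_integral ::
  "(real \<times> real \<Rightarrow> real) \<Rightarrow> (real \<Rightarrow> real \<times> real) \<Rightarrow> real" where
  "arc_length_integral \<phi> c = (LBINT t:{0..1}. \<phi> (c t) * norm (vector_derivative c (at t)))"

definition nu_integral :: "(real \<times> real \<Rightarrow> real) \<Rightarrow> real" where
  "nu_integral \<phi> = (LBINT \<rho>:{0..1}. (\<Sum>c\<leftarrow>D_boundary \<rho>. arc_length_integral \<phi> c))"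

definition L1_nu_norm :: "(real \<times> real \<Rightarrow> real) \<Rightarrow> real" where
  "L1_nu_norm \<phi> = nu_integral (\<lambda>z. \<bar>\<phi> z\<bar>)"

text \<open>Consistency of \<open>D_boundary\<close> with the topological boundary in the torus.\<close>

definition band :: "real \<Rightarrow> real set" where
  "band r = {x. \<exists>i::int. x + of_int i \<in> {-1/2<..1/2} \<and> \<bar>x + of_int i\<bar> \<le> r}"

lemma int_shift_ex: "\<exists>i::int. x + of_int i \<in> {-1/2<..1/2::real}"
proof
  show "x + of_int (- \<lceil>x - 1/2\<rceil>) \<in> {-1/2<..1/2}"
    using ceiling_correct[of "x - 1/2"] unfolding greaterThanAtMost_iff of_int_minus by linarith
qed

lemma band_full: assumes "1/2 \<le> r" shows "band r = UNIV"
proof -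
  have "x \<in> band r" for x
  proof -
    obtain i :: int where i: "x + of_int i \<in> {-1/2<..1/2}" using int_shift_ex by blast
    have "\<bar>x + of_int i\<bar> \<le> r" using i assms by auto
    with i show ?thesis unfolding band_def by blast
  qed
  then show ?thesis by blast
qed

lemma int_between: assumes "-1 < real_of_int i" "real_of_int i < 1" shows "i = 0"
  using assms by linarith

lemma closed_band: assumes "r < 1/2" shows "closed (band r)"
proof -
  have eq: "- band r = (\<Union>i::int. {x. r < x + of_int i \<and> x + of_int i < 1 - r})"
  proof (intro equalityI subsetI)
    fix x assume "x \<in> - band r"
    obtain i :: int where i: "x + of_int i \<in> {-1/2<..1/2}" using int_shift_ex by blast
    with \<open>x \<in> - band r\<close> have "\<bar>x + of_int i\<bar> > r" unfolding band_def by force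
    then consider "x + of_int i > r" | "x + of_int (i + 1) < 1 - r" by (auto simp: abs_if split: if_splits)
    then show "x \<in> (\<Union>i::int. {x. r < x + of_int i \<and> x + of_int i < 1 - r})"
    proof cases
      case 1 with i assms show ?thesis by (auto intro!: exI[of _ i])
    next
      case 2 with i assms show ?thesis by (auto intro!: exI[of _ "i + 1"])
    qed
  next
    fix x assume "x \<in> (\<Union>i::int. {x. r < x + of_int i \<and> x + of_int i < 1 - r})"
    then obtain i :: int where i: "r < x + of_int i" "x + of_int i < 1 - r" by auto
    show "x \<in> - band r"
    proof
      assume "x \<in> band r"
      then obtain j :: int where j: "\<bar>x + of_int j\<bar> \<le> r" unfolding band_def by auto
      have "0 < real_of_int (i - j)" "real_of_int (i - j) < 1" using i j by auto
      then show False using int_between[of "i - j"] by simp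
    qed
  qed
  have "open (\<Union>i::int. {x. r < x + real_of_int i \<and> x + of_int i < 1 - r})"
    by (intro open_UN ballI open_Collect_conj open_Collect_less continuous_intros)
  then show ?thesis using eq by (simp add: closed_def)
qed

lemma interior_band: assumes "0 < r" "r < 1/2"
  shows "interior (band r) = {x. \<exists>i::int. \<bar>x + of_int i\<bar> < r}"
proof (intro equalityI subsetI)
  fix x assume "x \<in> interior (band r)"
  then obtain d where d: "d > 0" "ball x d \<subseteq> band r" by (auto simp: mem_interior)
  then have "x \<in> band r" by auto
  then obtain i :: int where i: "\<bar>x + of_int i\<bar> \<le> r" unfolding band_def by auto
  have "\<bar>x + of_int i\<bar> \<noteq> r"
  proof
    assume eq: "\<bar>x + of_int i\<bar> = r"
    define t where "t = min (d/2) (1/2 - r)"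
    have t: "t > 0" "t < d" "t \<le> 1/2 - r" using d assms by (auto simp: t_def)
    define y where "y = (if x + of_int i > 0 then x + t else x - t)"
    have "y \<in> band r" using d t by (auto simp: y_def dist_real_def subset_iff)
    then obtain j :: int where j: "\<bar>y + of_int j\<bar> \<le> r" unfolding band_def by auto
    have y: "\<bar>y + of_int i\<bar> = r + t" using eq t assms by (auto simp: y_def abs_if split: if_splits)
    have "i - j = 0"
      by (rule int_between; use j y t assms in \<open>simp add: abs_if split: if_splits\<close>)
    then show False using j y t by simp
  qed
  then show "x \<in> {x. \<exists>i::int. \<bar>x + of_int i\<bar> < r}" using i by (auto intro!: exI[of _ i])
next
  fix x assume "x \<in> {x. \<exists>i::int. \<bar>x + of_int i\<bar> < r}"
  moreover have "open {x. \<exists>i::int. \<bar>x + of_int i\<bar> < r}"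
    by (intro open_Collect_ex open_Collect_less continuous_intros)
  moreover have "{x. \<exists>i::int. \<bar>x + of_int i\<bar> < r} \<subseteq> band r"
    unfolding band_def
  proof (intro Collect_mono ex_mono impI allI)
    fix x :: real and i :: int assume "\<bar>x + of_int i\<bar> < r"
    then show "x + of_int i \<in> {-1/2<..1/2} \<and> \<bar>x + of_int i\<bar> \<le> r" using assms by auto
  qed
  ultimately show "x \<in> interior (band r)" by (meson interiorI)
qed

lemma frontier_band: assumes "0 < r" "r < 1/2"
  shows "frontier (band r) = {x. \<exists>i::int. \<bar>x + of_int i\<bar> = r}"
proof -
  have "frontier (band r) = band r - {x. \<exists>i::int. \<bar>x + of_int i\<bar> < r}"
    using closed_band[OF assms(2)] interior_band[OF assms] by (simp add: frontier_def)
  also have "\<dots> = {x. \<exists>i::int. \<bar>x + of_int i\<bar> = r}"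
  proof (intro equalityI subsetI)
    fix x assume "x \<in> band r - {x. \<exists>i::int. \<bar>x + of_int i\<bar> < r}"
    then show "x \<in> {x. \<exists>i::int. \<bar>x + of_int i\<bar> = r}" unfolding band_def
      by (auto simp: not_less intro: antisym)
  next
    fix x assume "x \<in> {x. \<exists>i::int. \<bar>x + of_int i\<bar> = r}"
    then obtain i :: int where i: "\<bar>x + of_int i\<bar> = r" by auto
    have "x \<in> band r" using i assms unfolding band_def by (force simp: abs_if split: if_splits)
    moreover have False if j: "\<bar>x + of_int j\<bar> < r" for j :: int
    proof -
      have "i - j = 0"
        by (rule int_between; use j i assms in \<open>simp add: abs_if split: if_splits\<close>)
      with i j show False by simp
    qed
    ultimately show "x \<in> band r - {x. \<exists>i::int. \<bar>x + of_int i\<bar> < r}" by auto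
  qed
  finally show ?thesis .
qed

lemma torus_preimage_D_set: "torus_preimage (D_set \<rho>) = band \<rho> \<times> band (\<rho>\<^sup>2)"
  unfolding torus_preimage_def D_set_def band_def torus_cell_def by auto

lemma torus_preimage_Un: "torus_preimage (A \<union> B) = torus_preimage A \<union> torus_preimage B"
  unfolding torus_preimage_def by auto

lemma torus_preimage_Times:
  "torus_preimage (A \<times> B) = {x. \<exists>i::int. x + of_int i \<in> A} \<times> {y. \<exists>j::int. y + of_int j \<in> B}"
  unfolding torus_preimage_def by auto

lemma segment_horizontal:
  "closed_segment (a, c) (b, c) = closed_segment a b \<times> {c::real}" for a b :: real
proof -
  have "(1 - u) * c + u * c = c" for u by (simp add: algebra_simps)
  then show ?thesis unfolding closed_segment_def by auto
qed

lemma segment_vertical: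
  "closed_segment (c, a) (c, b) = {c::real} \<times> closed_segment a b" for a b :: real
proof -
  have "(1 - u) * c + u * c = c" for u by (simp add: algebra_simps)
  then show ?thesis unfolding closed_segment_def by auto
qed

lemma frontier_D_set:
  assumes "0 < \<rho>"
  shows "frontier (torus_preimage (D_set \<rho>)) =
         torus_preimage (\<Union>c\<in>set (D_boundary \<rho>). path_image c)"
proof -
  have band_iff: "x \<in> band r \<longleftrightarrow> (\<exists>i::int. \<bar>x + of_int i\<bar> \<le> r)" if "0 \<le> r" "r < 1/2" for x r
    using that unfolding band_def by (force simp: abs_if split: if_splits)
  have fr: "frontier (band r \<times> band s) =
      band r \<times> band s - interior (band r) \<times> interior (band s)"
    if "closed (band r)" "closed (band s)" for r s
    using that by (simp add: frontier_def closure_Times interior_Times)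
  have s0: "0 < \<rho>\<^sup>2" using assms by simp
  consider "\<rho> < 1/2" "\<rho>\<^sup>2 < 1/2" | "1/2 \<le> \<rho>" "\<rho>\<^sup>2 < 1/2" | "1/2 \<le> \<rho>" "1/2 \<le> \<rho>\<^sup>2"
  proof (cases "\<rho> < 1/2")
    case True
    have "\<rho>\<^sup>2 \<le> \<rho> * 1" unfolding power2_eq_square
      using True assms by (intro mult_left_mono) auto
    with True that show ?thesis by linarith
  qed (use that in linarith)
  then show ?thesis
  proof cases
    case 1
    have "frontier (band \<rho> \<times> band (\<rho>\<^sup>2)) =
        (frontier (band \<rho>) \<times> band (\<rho>\<^sup>2)) \<union> (band \<rho> \<times> frontier (band (\<rho>\<^sup>2)))"
      using 1 closed_band[of \<rho>] closed_band[of "\<rho>\<^sup>2"] fr[of \<rho> "\<rho>\<^sup>2"]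
      by (auto simp: frontier_def)
    also have "\<dots> = torus_preimage ({x. \<bar>x\<bar> = \<rho>} \<times> {y. \<bar>y\<bar> \<le> \<rho>\<^sup>2} \<union>
        {x. \<bar>x\<bar> \<le> \<rho>} \<times> {y. \<bar>y\<bar> = \<rho>\<^sup>2})"
      using 1 assms s0 unfolding torus_preimage_Un torus_preimage_Times
      by (auto simp: frontier_band band_iff)
    also have "{x. \<bar>x\<bar> = \<rho>} \<times> {y. \<bar>y\<bar> \<le> \<rho>\<^sup>2} \<union> {x. \<bar>x\<bar> \<le> \<rho>} \<times> {y. \<bar>y\<bar> = \<rho>\<^sup>2} =
        (\<Union>c\<in>set (D_boundary \<rho>). path_image c)"
      using 1 assms s0
      by (auto simp: D_boundary_def segment_horizontal segment_vertical closed_segment_eq_real_ivl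
          abs_le_iff abs_if split: if_splits)
    finally show ?thesis by (simp add: torus_preimage_D_set)
  next
    case 2
    have "frontier (band \<rho> \<times> band (\<rho>\<^sup>2)) = UNIV \<times> frontier (band (\<rho>\<^sup>2))"
      using 2 closed_band[of "\<rho>\<^sup>2"] fr[of \<rho> "\<rho>\<^sup>2"] by (auto simp: frontier_def band_full)
    also have "\<dots> = torus_preimage ({x. \<bar>x\<bar> \<le> 1/2} \<times> {y. \<bar>y\<bar> = \<rho>\<^sup>2})"
    proof -
      have "\<exists>i::int. \<bar>x + of_int i\<bar> \<le> 1/2" for x :: real
      proof -
        obtain i :: int where "x + of_int i \<in> {-1/2<..1/2}" using int_shift_ex by blast
        then have "\<bar>x + of_int i\<bar> \<le> 1/2" unfolding greaterThanAtMost_iff by linarith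
        then show ?thesis by blast
      qed
      with 2 s0 show ?thesis
        using frontier_band[of "\<rho>\<^sup>2"] by (auto simp: torus_preimage_Times)
    qed
    also have "({x. \<bar>x\<bar> \<le> 1/2} \<times> {y. \<bar>y\<bar> = \<rho>\<^sup>2}) = (\<Union>c\<in>set (D_boundary \<rho>). path_image c)"
      using 2 assms s0
      by (auto simp: D_boundary_def segment_horizontal closed_segment_eq_real_ivl
          abs_le_iff abs_if split: if_splits)
    finally show ?thesis by (simp add: torus_preimage_D_set)
  next
    case 3
    then show ?thesis unfolding torus_preimage_D_set
      by (simp add: band_full D_boundary_def torus_preimage_def)
  qed
qed

end

theory Submission
  imports Defs "HOL-Library.Periodic_Fun"
begin

text \<open>
  Near the fixed point the dynamics is slow: \<open>T\<^sup>n\<close> maps a box \<open>\<bar>x\<bar> \<le> r, \<bar>y\<bar> \<le> r\<^sup>2\<close> with \<open>r = c / n\<close>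
  into the box \<open>\<bar>x\<bar> \<le> 2 r, \<bar>y\<bar> \<le> 2 r\<^sup>2\<close> if \<open>c\<close> is small. Take for \<open>f\<close> a bump supported in the
  first box and for \<open>g\<close> a fixed function vanishing to second order at the fixed point. The
  correlation \<open>\<integral> (f \<circ> T\<^bsup>-n\<^esup>) g\<close> is \<open>O(r\<^sup>5)\<close>, whereas \<open>\<integral> f \<integral> g\<close> has order \<open>r\<^sup>3\<close>. The measure \<open>\<nu>\<close>
  gives mass \<open>O(r\<^sup>2)\<close> to the box, and \<open>\<partial>\<^sup>u f = O(1 / r)\<close> because the slope of the unstable
  direction is \<open>O(\<surd>(x\<^sup>2 + \<bar>y\<bar>))\<close>. Hence \<open>r\<^sup>3 \<le> const \<cdot> r \<cdot> \<gamma>\<^sub>n\<close>.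
\<close>

section \<open>The circle map\<close>

lemma circle_map_lift_iterated_DERIV:
  assumes "circle_map_lift h"
  shows "((deriv ^^ k) h has_real_derivative (deriv ^^ Suc k) h x) (at x)"
  using assms unfolding circle_map_lift_def
  by (simp add: DERIV_deriv_iff_real_differentiable)

lemma circle_map_lift_DERIV:
  assumes "circle_map_lift h"
  shows "(h has_real_derivative deriv h x) (at x)"
  using circle_map_lift_iterated_DERIV[OF assms, of 0 x] by simp

lemma circle_map_lift_add_int:
  assumes "circle_map_lift h"
  shows "h (x + of_int i) - h x \<in> \<int>"
proof -
  have step: "h (y + 1) - h y \<in> \<int>" for y
    using assms unfolding circle_map_lift_def by blast
  show ?thesis
  proof (induction i rule: int_induct[where k = 0])
    case (step1 i)
    have "h (x + of_int (i + 1)) - h x = (h (x + of_int i + 1) - h (x + of_int i)) + (h (x + of_int i) - h x)"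
      by (simp add: add.assoc)
    then show ?case using step[of "x + of_int i"] step1 by (metis Ints_add)
  next
    case (step2 i)
    have "h (x + of_int (i - 1)) - h x = (h (x + of_int i) - h x) - (h (x + of_int (i - 1) + 1) - h (x + of_int (i - 1)))"
      by simp
    then show ?case using step[of "x + of_int (i - 1)"] step2 by (metis Ints_diff)
  qed simp
qed

text \<open>The difference \<open>h (y + of_int i) - h y\<close> is continuous in \<open>y\<close>
  and integer-valued, hence constant, so its derivative vanishes.\<close>

lemma circle_map_lift_deriv_periodic:
  assumes "circle_map_lift h"
  shows "deriv h (x + of_int i) = deriv h x"
proof -
  define d where "d y = h (y + of_int i) - h y" for y
  have D: "(d has_real_derivative deriv h (y + of_int i) - deriv h y) (at y)" for y
    unfolding d_def
    by (auto intro!: derivative_eq_intros DERIV_chain'[OF _ circle_map_lift_DERIV[OF assms], of _ 1]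
        circle_map_lift_DERIV[OF assms])
  have "d constant_on UNIV"
  proof (rule continuous_discrete_range_constant)
    show "continuous_on UNIV d"
      using D DERIV_isCont by (blast intro: continuous_at_imp_continuous_on)
    fix y
    have "norm (d w - d y) \<ge> 1" if "d w \<noteq> d y" for w
    proof -
      have "d w - d y \<in> \<int>" unfolding d_def
        by (intro Ints_diff[OF circle_map_lift_add_int circle_map_lift_add_int] assms)
      then show ?thesis using that Ints_nonzero_abs_ge1 by fastforce
    qed
    then show "\<exists>e>0. \<forall>w. w \<in> UNIV \<and> d w \<noteq> d y \<longrightarrow> e \<le> norm (d w - d y)"
      by (intro exI[of _ 1]) auto
  qed simp
  then obtain c where "d = (\<lambda>_. c)" unfolding constant_on_def by auto
  then show ?thesis using DERIV_unique[OF D[of x], of 0] by simp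
qed

lemma circle_map_lift_deriv_nonneg:
  assumes "circle_map_lift h"
  shows "0 \<le> deriv h x"
proof (cases "x \<in> \<int>")
  case True
  then obtain i where "x = 0 + of_int i" by (auto elim: Ints_cases)
  then have "deriv h x = deriv h 0" using circle_map_lift_deriv_periodic[OF assms, of 0 i] by simp
  then show ?thesis using assms by (simp add: circle_map_lift_def)
qed (use assms in \<open>auto simp: circle_map_lift_def intro: less_imp_le\<close>)

text \<open>A bound for the third derivative on \<open>{-1..1}\<close> is carried up to
  \<open>h\<close> by three applications of the mean value theorem. Both \<open>deriv h\<close> and
  the second derivative vanish at 0, so each application gains one power of
  \<open>\<bar>x\<bar>\<close>.\<close>

lemma circle_map_lift_flat:
  assumes "circle_map_lift h"
  shows "\<exists>A>0. \<forall>x. \<bar>x\<bar> \<le> 1 \<longrightarrow> deriv h x \<le> A * x\<^sup>2 \<and> \<bar>h x - h 0\<bar> \<le> A * \<bar>x\<bar> ^ 3"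
proof -
  define p q r where "p = deriv h" and "q = deriv p" and "r = deriv q"
  note D = circle_map_lift_iterated_DERIV[OF assms]
  have Dh: "(h has_real_derivative p x) (at x)" and Dp: "(p has_real_derivative q x) (at x)"
    and Dq: "(q has_real_derivative r x) (at x)" and Dr: "isCont r x" for x
    using D[of 0 x] D[of 1 x] D[of 2 x] D[of 3 x, THEN DERIV_isCont]
    by (simp_all add: p_def q_def r_def numeral_eq_Suc)
  have p0: "p 0 = 0" using assms by (simp add: circle_map_lift_def p_def)
  have pos: "0 \<le> p x" for x using circle_map_lift_deriv_nonneg[OF assms] by (simp add: p_def)
  \<comment> \<open>The nonnegative function \<open>p\<close> vanishes at 0, so 0 is a minimum of
    \<open>p\<close>.\<close>
  have q0: "q 0 = 0" by (rule DERIV_local_min[OF Dp, of 1]) (use pos p0 in auto)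
  have mvt: "\<exists>\<xi>. \<bar>\<xi>\<bar> \<le> \<bar>x\<bar> \<and> F x - F 0 = x * F' \<xi>"
    if "\<And>x. (F has_real_derivative F' x) (at x)" for F F' :: "real \<Rightarrow> real" and x
  proof (cases x "0::real" rule: linorder_cases)
    case less
    with MVT2[OF this, of F F'] that obtain z where "x < z" "z < 0" "F 0 - F x = (0 - x) * F' z" by blast
    then show ?thesis by (intro exI[of _ z]) auto
  next
    case greater
    with MVT2[OF this, of F F'] that obtain z where "0 < z" "z < x" "F x - F 0 = (x - 0) * F' z" by blast
    then show ?thesis by (intro exI[of _ z]) auto
  qed auto
  have "bounded (r ` {-1..1})"
    by (intro compact_imp_bounded compact_continuous_image continuous_at_imp_continuous_on) (use Dr in auto)
  then obtain A where A: "0 < A" "\<And>x. x \<in> {-1..1} \<Longrightarrow> \<bar>r x\<bar> \<le> A"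
    unfolding bounded_pos by auto
  have q: "\<bar>q x\<bar> \<le> A * \<bar>x\<bar>" if "\<bar>x\<bar> \<le> 1" for x
  proof -
    obtain \<xi> where "\<bar>\<xi>\<bar> \<le> \<bar>x\<bar>" "q x - q 0 = x * r \<xi>" using mvt[OF Dq] by blast
    then show ?thesis using A(2)[of \<xi>] that q0
        by (auto simp: abs_mult mult.commute[of A] abs_le_iff intro!: mult_left_mono)
  qed
  have p: "\<bar>p x\<bar> \<le> A * x\<^sup>2" if "\<bar>x\<bar> \<le> 1" for x
  proof -
    obtain \<xi> where \<xi>: "\<bar>\<xi>\<bar> \<le> \<bar>x\<bar>" "p x - p 0 = x * q \<xi>" using mvt[OF Dp] by blast
    have "\<bar>q \<xi>\<bar> \<le> A * \<bar>\<xi>\<bar>" using q[of \<xi>] \<xi>(1) that by linarith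
    also have "\<dots> \<le> A * \<bar>x\<bar>" using \<xi> A by (intro mult_left_mono) auto
    finally have "\<bar>x\<bar> * \<bar>q \<xi>\<bar> \<le> \<bar>x\<bar> * (A * \<bar>x\<bar>)" by (intro mult_left_mono) auto
    also have "\<dots> = A * x\<^sup>2" by (simp add: power2_eq_square)
    finally show ?thesis using \<xi>(2) p0 by (simp add: abs_mult)
  qed
  have h: "\<bar>h x - h 0\<bar> \<le> A * \<bar>x\<bar> ^ 3" if "\<bar>x\<bar> \<le> 1" for x
  proof -
    obtain \<xi> where \<xi>: "\<bar>\<xi>\<bar> \<le> \<bar>x\<bar>" "h x - h 0 = x * p \<xi>" using mvt[OF Dh] by blast
    have "\<bar>p \<xi>\<bar> \<le> A * \<xi>\<^sup>2" using p[of \<xi>] \<xi>(1) that by linarith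
    also have "\<dots> \<le> A * x\<^sup>2" using \<xi> A by (intro mult_left_mono) (auto simp: abs_le_square_iff)
    finally have "\<bar>x\<bar> * \<bar>p \<xi>\<bar> \<le> \<bar>x\<bar> * (A * x\<^sup>2)" by (intro mult_left_mono) auto
    also have "\<dots> = A * \<bar>x\<bar> ^ 3" by (simp add: power2_eq_square power3_eq_cube)
    finally show ?thesis using \<xi>(2) by (simp add: abs_mult)
  qed
  show ?thesis
    using A(1) p h by (intro exI[of _ A]) (auto simp: p_def[symmetric] intro: abs_le_D1)
qed

section \<open>Slopes along backward orbits\<close>

text \<open>A size adapted to the parabolic scaling: it is comparable to
  \<open>max \<bar>x\<bar> (sqrt \<bar>y\<bar>)\<close>, so its sublevel sets are comparable to the
  boxes \<open>\<bar>x\<bar> \<le> r\<close>, \<open>\<bar>y\<bar> \<le> r\<^sup>2\<close>.\<close>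

definition parab :: "real \<Rightarrow> real \<Rightarrow> real" where
  "parab x y = sqrt (x\<^sup>2 + \<bar>y\<bar>)"

lemma parab_bounds:
  assumes "parab x y \<le> r"
  shows "\<bar>x\<bar> \<le> r" "\<bar>y\<bar> \<le> r\<^sup>2" "x\<^sup>2 + \<bar>y\<bar> \<le> r\<^sup>2"
proof -
  have r: "0 \<le> r" using assms unfolding parab_def by (meson order_trans real_sqrt_ge_zero add_nonneg_nonneg abs_ge_zero zero_le_power2)
  show *: "x\<^sup>2 + \<bar>y\<bar> \<le> r\<^sup>2" using assms unfolding parab_def by (rule sqrt_le_D)
  then have "x\<^sup>2 \<le> r\<^sup>2" by linarith
  then show "\<bar>x\<bar> \<le> r" using r by (simp add: abs_le_square_iff[symmetric])
  show "\<bar>y\<bar> \<le> r\<^sup>2" using * by (smt (verit) zero_le_power2)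
qed

lemma parab_le:
  assumes "x\<^sup>2 + \<bar>y\<bar> \<le> r\<^sup>2" "0 \<le> r"
  shows "parab x y \<le> r"
  using assms unfolding parab_def by (simp add: real_le_lsqrt)

text \<open>With \<open>p\<close> the derivative of \<open>h\<close> at \<open>x\<close>, the
  Jacobian of \<open>T\<close> sends the vector \<open>(1, u)\<close> to
  \<open>(1 + p + u, p + u)\<close>, so the left side is the slope at the image point;
  \<open>H\<close> stands for \<open>h x - h 0\<close>. The bound survives one step because the
  division by \<open>1 + p + u\<close> gains order \<open>K * K * r\<^sup>2\<close>, which pays for
  the addition of \<open>p\<close> and for the larger \<open>parab\<close> of the preimage.\<close>

lemma slope_bound_step:
  fixes A K x y H p u :: real
  assumes "0 \<le> A" and K: "K = 9 * A + 4"
    and p: "0 \<le> p" "\<bar>x\<bar> \<le> 1 \<Longrightarrow> p \<le> A * x\<^sup>2"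
    and H: "\<bar>x\<bar> \<le> 1 \<Longrightarrow> \<bar>H\<bar> \<le> A * \<bar>x\<bar> ^ 3"
    and u: "0 \<le> u" "u \<le> K * parab x y"
  shows "(p + u) / (1 + p + u) \<le> K * parab (x + H + y) (H + y)"
proof (cases "K * parab (x + H + y) (H + y) \<ge> 1")
  case True
  then show ?thesis using p u by (smt (verit) divide_le_eq_1)
next
  case False
  define r where "r = parab (x + H + y) (H + y)"
  have K4: "K \<ge> 4" using K assms(1) by simp
  have r0: "0 \<le> r" by (simp add: r_def parab_def)
  have "4 * r \<le> K * r" using K4 r0 by (intro mult_right_mono)
  then have r1: "r \<le> 1/4" using False unfolding r_def by linarith
  have xy: "\<bar>x + H + y\<bar> \<le> r" "\<bar>H + y\<bar> \<le> r\<^sup>2" "(x + H + y)\<^sup>2 + \<bar>H + y\<bar> \<le> r\<^sup>2"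
    using parab_bounds[of "x + H + y" "H + y" r] by (auto simp: r_def)
  have rr: "r\<^sup>2 \<le> r" using r0 r1 by (simp add: power2_eq_square mult_left_le_one_le)
  have x2r: "\<bar>x\<bar> \<le> 2 * r" using xy(1,2) rr by linarith
  then have x1: "\<bar>x\<bar> \<le> 1" using r1 by linarith
  have x3: "\<bar>x\<bar> ^ 3 \<le> (2 * r) ^ 3" using x2r by (intro power_mono) auto
  have Hr: "\<bar>H\<bar> \<le> 8 * A * r ^ 3"
    using order_trans[OF H[OF x1] mult_left_mono[OF x3 assms(1)]] by (simp add: power_mult_distrib)
  have x2: "x\<^sup>2 \<le> (2 * r)\<^sup>2" using power_mono[OF x2r, of 2] by simp
  have pr: "p \<le> 4 * A * r\<^sup>2"
    using order_trans[OF p(2)[OF x1] mult_left_mono[OF x2 assms(1)]] by (simp add: power_mult_distrib)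
  have "\<bar>x + H + y\<bar> * \<bar>H + y\<bar> \<le> r * r\<^sup>2" using xy r0 by (intro mult_mono) auto
  then have "- ((x + H + y) * (H + y)) \<le> r ^ 3"
    by (metis abs_mult abs_le_D2 power2_eq_square power3_eq_cube mult.assoc)
  moreover have "(H + y)\<^sup>2 \<le> r ^ 3"
  proof -
    have "(H + y)\<^sup>2 = \<bar>H + y\<bar> * \<bar>H + y\<bar>" by (simp add: power2_eq_square)
    also have "\<dots> \<le> r * r\<^sup>2" using xy(2) rr r0 by (intro mult_mono) auto
    finally show ?thesis by (simp add: power2_eq_square power3_eq_cube)
  qed
  \<comment> \<open>The old first coordinate is the difference of the two new coordinates; the cross
    term costs at most \<open>2 * r ^ 3\<close> and the square at most \<open>r ^ 3\<close>.\<close>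
  moreover have "x\<^sup>2 = (x + H + y)\<^sup>2 - 2 * ((x + H + y) * (H + y)) + (H + y)\<^sup>2"
    by (simp add: power2_eq_square algebra_simps)
  ultimately have "x\<^sup>2 + \<bar>y\<bar> \<le> (x + H + y)\<^sup>2 + 3 * r ^ 3 + \<bar>H + y\<bar> + \<bar>H\<bar>" by linarith
  also have "\<dots> \<le> r\<^sup>2 + (3 + 8 * A) * r ^ 3" using xy(3) Hr by (simp add: algebra_simps)
  \<comment> \<open>The coefficient \<open>2 + 4 * A\<close> is taken so that its double dominates
    \<open>3 + 8 * A\<close>, which completes the square.\<close>
  also have "\<dots> \<le> (r + (2 + 4 * A) * r\<^sup>2)\<^sup>2"
  proof -
    have "(r + (2 + 4 * A) * r\<^sup>2)\<^sup>2 = r\<^sup>2 + (3 + 8 * A) * r ^ 3 + (r ^ 3 + ((2 + 4 * A) * r\<^sup>2)\<^sup>2)"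
      by (simp add: power2_eq_square power3_eq_cube algebra_simps)
    then show ?thesis using r0 by simp
  qed
  finally have "parab x y \<le> r + (2 + 4 * A) * r\<^sup>2" using r0 assms(1) by (intro parab_le) auto
  then have uK: "u \<le> K * (r + (2 + 4 * A) * r\<^sup>2)" using u(2) K4 by (smt (verit) mult_left_mono)
  define U where "U = K * (r + (2 + 4 * A) * r\<^sup>2)"
  have uU: "u \<le> U" using uK by (simp add: U_def)
  have UKr: "K * r \<le> U" using K4 r0 assms(1) by (simp add: U_def)
  \<comment> \<open>Here the value of \<open>K\<close> enters: it splits as
    \<open>(2 + 4 * A) + (5 * A + 2)\<close>, and \<open>K * (5 * A + 2)\<close> absorbs the
    \<open>4 * A\<close> that comes from \<open>p\<close>.\<close>
  have "p + U \<le> K * r * (1 + p + U)"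
  proof -
    have "4 * A + K * (2 + 4 * A) \<le> K * K"
    proof -
      have eq: "(2 + 4 * A) + (5 * A + 2) = K" using K by linarith
      have "4 * A \<le> 1 * (5 * A + 2)" using assms(1) by simp
      also have "\<dots> \<le> K * (5 * A + 2)" using K4 assms(1) by (intro mult_right_mono) simp_all
      finally have "K * (2 + 4 * A) + 4 * A \<le> K * (2 + 4 * A) + K * (5 * A + 2)" by (rule add_left_mono)
      also have "\<dots> = K * ((2 + 4 * A) + (5 * A + 2))" by (rule distrib_left[symmetric])
      finally show ?thesis unfolding eq by (simp only: add.commute)
    qed
    then have "(4 * A + K * (2 + 4 * A)) * r\<^sup>2 \<le> K * K * r\<^sup>2" by (intro mult_right_mono) auto
    also have "\<dots> = K * r * (K * r)" by (simp add: power2_eq_square)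
    also have "\<dots> \<le> K * r * (p + U)" using UKr p K4 r0 by (intro mult_left_mono) auto
    finally show ?thesis using pr unfolding U_def by (simp add: algebra_simps)
  qed
  moreover have "0 < 1 + p + U" using p u uU by linarith
  ultimately have "(p + U) / (1 + p + U) \<le> K * r" by (simp add: divide_le_eq)
  \<comment> \<open>The slope map is increasing in \<open>u\<close>, so \<open>u\<close> may be
    replaced by its upper bound \<open>U\<close>.\<close>
  moreover have "(p + u) / (1 + p + u) \<le> (p + U) / (1 + p + U)"
    using p u uU by (simp add: divide_le_eq frac_le_eq) (simp add: field_simps)
  ultimately show ?thesis by (simp add: r_def)
qed

text \<open>
  If the bound fails along the whole backward orbit, the slopes grow backwards at least
  linearly, which contradicts the bound by 1; otherwise the bound is propagated forwards.
\<close>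

lemma slope_bound_backward_orbit:
  fixes u :: "nat \<Rightarrow> real" and z :: "nat \<Rightarrow> real \<times> real"
  assumes h: "circle_map_lift h" and "0 \<le> A" and K: "K = 9 * A + 4"
    and A: "\<And>x. \<bar>x\<bar> \<le> 1 \<Longrightarrow> deriv h x \<le> A * x\<^sup>2"
      "\<And>x. \<bar>x\<bar> \<le> 1 \<Longrightarrow> \<bar>h x - h 0\<bar> \<le> A * \<bar>x\<bar> ^ 3"
    and z: "\<And>n. z n = T_lift h (z (Suc n))"
    and u: "\<And>n. 0 \<le> u n" "\<And>n. u n \<le> 1"
      "\<And>n. u n = (deriv h (fst (z (Suc n))) + u (Suc n)) / (1 + deriv h (fst (z (Suc n))) + u (Suc n))"
  shows "u 0 \<le> K * parab (fst (z 0)) (snd (z 0))"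
proof -
  \<comment> \<open>The orbit lives in the plane and is not reduced modulo 1. The bound is therefore
    stated for all integer translates, which makes it a statement about the point of the
    torus.\<close>
  define good where "good n \<longleftrightarrow>
    (\<forall>i j :: int. u n \<le> K * parab (fst (z n) + of_int i) (snd (z n) + of_int j))" for n
  note pos = circle_map_lift_deriv_nonneg[OF h]
  have K4: "K \<ge> 4" using K assms(2) by simp
  have h0: "h 0 \<in> \<int>" using h by (simp add: circle_map_lift_def)
  have step: "good n" if "good (Suc n)" for n
    unfolding good_def
  proof (intro allI)
    fix i j :: int
    obtain x y where xy: "z (Suc n) = (x, y)" by fastforce
    \<comment> \<open>The pair \<open>(k, l)\<close> is chosen so that the map with
      \<open>h - h 0\<close> in place of \<open>h\<close> carries this translate of
      \<open>z (Suc n)\<close> to the translate of \<open>z n\<close> by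
      \<open>(i, j)\<close>.\<close>
    define k where "k = i - j"
    have "h (x + of_int k) - h x + h 0 \<in> \<int>" by (intro Ints_add circle_map_lift_add_int[OF h] h0)
    then obtain m where m: "h (x + of_int k) - h x + h 0 = of_int m" by (metis Ints_cases)
    obtain m0 where m0: "h 0 = of_int m0" using h0 by (metis Ints_cases)
    define H where "H = h (x + of_int k) - h 0"
    define l where "l = j - m + 2 * m0"
    have hx: "h x = H + 2 * of_int m0 - of_int m" unfolding H_def using m m0 by linarith
    have zn: "z n = (x + h x + y, h x + y)" using z[of n] xy by (simp add: T_lift_def)
    have z1: "fst (z n) + of_int i = (x + of_int k) + H + (y + of_int l)"
      and z2: "snd (z n) + of_int j = H + (y + of_int l)"
      by (simp_all add: zn hx l_def k_def)
    have "(deriv h x + u (Suc n)) / (1 + deriv h x + u (Suc n)) \<le>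
        K * parab ((x + of_int k) + H + (y + of_int l)) (H + (y + of_int l))"
    proof (rule slope_bound_step[OF assms(2) K])
      have "deriv h (x + of_int k) = deriv h x" by (rule circle_map_lift_deriv_periodic[OF h])
      then show "deriv h x \<le> A * (x + real_of_int k)\<^sup>2" if "\<bar>x + real_of_int k\<bar> \<le> 1"
        using A(1)[OF that] by simp
      show "u (Suc n) \<le> K * parab (x + real_of_int k) (y + real_of_int l)"
        using that xy unfolding good_def by auto
    qed (use pos u(1) A(2) in \<open>auto simp: H_def\<close>)
    then show "u n \<le> K * parab (fst (z n) + of_int i) (snd (z n) + of_int j)"
      unfolding z1 z2 u(3)[of n] by (simp only: xy fst_conv)
  qed
  have "good 0"
  proof (rule ccontr)
    assume "\<not> good 0"
    then have bad: "\<not> good n" for n by (induction n) (use step in auto)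
    \<comment> \<open>Failure of the bound gives a translate whose \<open>parab\<close> is below
      \<open>u n / K\<close>. By flatness the derivative of \<open>h\<close> there is at most
      \<open>A * (u n / K)\<^sup>2\<close>, and \<open>2 * A \<le> K * K\<close> yields the factor
      1/2.\<close>
    have small: "deriv h (fst (z n)) \<le> (u n)\<^sup>2 / 2" and upos: "0 < u n" for n
    proof -
      obtain i j :: int where ij: "K * parab (fst (z n) + of_int i) (snd (z n) + of_int j) < u n"
        using bad[of n] unfolding good_def by (auto simp: not_le)
      define x where "x = fst (z n) + of_int i"
      define \<rho> where "\<rho> = parab x (snd (z n) + of_int j)"
      have \<rho>: "K * \<rho> < u n" "0 \<le> \<rho>" using ij by (auto simp: \<rho>_def x_def parab_def)
      show "0 < u n" using \<rho> K4 by (smt (verit) mult_nonneg_nonneg)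
      have "1 * \<rho> \<le> K * \<rho>" using \<rho> K4 by (intro mult_right_mono) auto
      then have "\<rho> \<le> 1" using \<rho> u(2)[of n] by linarith
      moreover have x: "\<bar>x\<bar> \<le> \<rho>" using parab_bounds(1)[of x _ \<rho>] by (auto simp: \<rho>_def)
      ultimately have "deriv h x \<le> A * x\<^sup>2" by (intro A) auto
      also have "\<dots> \<le> A * \<rho>\<^sup>2" using x \<rho> assms(2) by (intro mult_left_mono) (auto simp: abs_le_square_iff[symmetric])
      finally have "2 * deriv h x \<le> 2 * A * \<rho>\<^sup>2" by simp
      also have "\<dots> \<le> K * K * \<rho>\<^sup>2"
      proof (intro mult_right_mono)
        have "1 * K \<le> K * K" using K4 by (intro mult_right_mono) auto
        then show "2 * A \<le> K * K" using K assms(2) by linarith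
      qed auto
      also have "\<dots> = (K * \<rho>)\<^sup>2" by (simp add: power2_eq_square)
      also have "\<dots> \<le> (u n)\<^sup>2" using \<rho> K4 by (intro power_mono) auto
      finally have "2 * deriv h x \<le> (u n)\<^sup>2" .
      moreover have "deriv h x = deriv h (fst (z n))"
        unfolding x_def by (rule circle_map_lift_deriv_periodic[OF h])
      ultimately show "deriv h (fst (z n)) \<le> (u n)\<^sup>2 / 2" by linarith
    qed
    \<comment> \<open>In \<open>(p + v) / (1 + p + v)\<close> the division costs
      \<open>v\<^sup>2\<close>, of which \<open>p\<close> gives back at most one half, and the
      denominator is at most 3; hence the loss \<open>v\<^sup>2 / 6\<close>.\<close>
    have grow: "u n + (u (Suc n))\<^sup>2 / 6 \<le> u (Suc n)" for n
    proof -
      define p v where "p = deriv h (fst (z (Suc n)))" and "v = u (Suc n)"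
      have v: "0 \<le> v" "v \<le> 1" "0 \<le> p" "p \<le> v\<^sup>2 / 2"
        using u(1,2) small[of "Suc n"] pos by (auto simp: p_def v_def)
      have "v\<^sup>2 \<le> 1" using v by (simp add: power_le_one)
      then have p1: "p \<le> 1" using v by linarith
      have s: "0 < 1 + p + v" "1 + p + v \<le> 3" using v p1 by auto
      have "p + v \<le> (v - v\<^sup>2 / 6) * (1 + p + v)"
      proof -
        have "v\<^sup>2 * (1 + p + v) \<le> v\<^sup>2 * 3" using s by (intro mult_left_mono) auto
        moreover have "0 \<le> v * p" using v by simp
        moreover have "(v - v\<^sup>2 / 6) * (1 + p + v) = v + v * p + v\<^sup>2 - v\<^sup>2 * (1 + p + v) / 6"
          by (simp add: algebra_simps power2_eq_square)
        ultimately show ?thesis using v(4) by linarith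
      qed
      then have "u n \<le> v - v\<^sup>2 / 6"
        using u(3)[of n] s unfolding p_def[symmetric] v_def[symmetric] by (simp add: divide_le_eq)
      then show ?thesis by (simp add: v_def)
    qed
    have lin: "u 0 + real n * ((u 0)\<^sup>2 / 6) \<le> u n" for n
    proof (induction n)
      case (Suc n)
      have "u 0 \<le> u n" using Suc by (smt (verit) of_nat_0_le_iff mult_nonneg_nonneg zero_le_power2 divide_nonneg_nonneg)
      moreover have "u n \<le> u (Suc n)" using grow[of n] by (smt (verit) zero_le_power2 divide_nonneg_nonneg)
      ultimately have "(u 0)\<^sup>2 \<le> (u (Suc n))\<^sup>2" using u(1) by (intro power_mono) auto
      then show ?case using Suc grow[of n] by (simp add: algebra_simps add_divide_distrib)
    qed simp
    obtain n where "1 / ((u 0)\<^sup>2 / 6) < real n" using reals_Archimedean2 by blast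
    then have "1 < real n * ((u 0)\<^sup>2 / 6)" using upos[of 0] by (simp add: field_simps)
    then show False using lin[of n] u(2)[of n] upos[of 0] by linarith
  qed
  then show ?thesis unfolding good_def by (metis add.right_neutral of_int_0)
qed

section \<open>The unstable line field\<close>

lemma inv_T_lift: "inv (T_lift h) = (\<lambda>z. (fst z - snd z, snd z - h (fst z - snd z)))"
proof
  fix z :: "real \<times> real"
  have "T_lift h (fst z - snd z, snd z - h (fst z - snd z)) = z" by (simp add: T_lift_inverse)
  then show "inv (T_lift h) z = (fst z - snd z, snd z - h (fst z - snd z))"
    using bij_T_lift[of h] by (metis bij_is_inj inv_f_f)
qed

text \<open>The image of \<open>v\<close> under the derivative of the n-th backward iterate at
  \<open>z\<close>, built from one inverse Jacobian at a time. The derivative of \<open>h\<close> is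
  taken at the point reached after the step, hence the exponent \<open>Suc n\<close>.\<close>

primrec backward_tangent ::
  "(real \<Rightarrow> real) \<Rightarrow> real \<times> real \<Rightarrow> real \<times> real \<Rightarrow> nat \<Rightarrow> real \<times> real" where
  "backward_tangent h z v 0 = v"
| "backward_tangent h z v (Suc n) =
    (fst (backward_tangent h z v n) - snd (backward_tangent h z v n),
     snd (backward_tangent h z v n) - deriv h (fst ((inv (T_lift h) ^^ Suc n) z)) *
       (fst (backward_tangent h z v n) - snd (backward_tangent h z v n)))"

lemma has_derivative_backward_tangent:
  assumes "circle_map_lift h"
  shows "((inv (T_lift h) ^^ n) has_derivative (\<lambda>v. backward_tangent h z v n)) (at z)"
proof (induction n)
  case (Suc n)
  let ?S = "inv (T_lift h)" and ?w = "(inv (T_lift h) ^^ n) z"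
  define c where "c = deriv h (fst (?S ?w))"
  have c: "(h has_real_derivative c) (at (fst ?w - snd ?w))"
    using circle_map_lift_DERIV[OF assms] by (simp add: c_def inv_T_lift)
  have "((\<lambda>w. h (fst w - snd w)) has_derivative (\<lambda>v. (fst v - snd v) * c)) (at ?w)"
    by (rule DERIV_compose_FDERIV[where g = "\<lambda>w. fst w - snd w", OF c]) (auto intro!: derivative_eq_intros)
  then have "(?S has_derivative (\<lambda>v. (fst v - snd v, snd v - (fst v - snd v) * c))) (at ?w)"
    unfolding inv_T_lift by (auto intro!: derivative_intros)
  from diff_chain_at[OF Suc this]
  show ?case by (simp add: o_def c_def mult.commute)
qed (simp add: id_def)

lemma growth_rate_backward:
  assumes "circle_map_lift h" "1 \<le> n"
  shows "growth_rate h z v (- int n) = - ln (norm (backward_tangent h z v n)) / real n"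
proof -
  have "T_pow h (- int n) = inv (T_lift h) ^^ n" using assms(2) by (simp add: T_pow_def)
  then show ?thesis
    using frechet_derivative_at[OF has_derivative_backward_tangent[OF assms(1), of n z], symmetric]
    by (simp add: growth_rate_def)
qed

lemma backward_tangent_nonzero:
  "v \<noteq> 0 \<Longrightarrow> backward_tangent h z v n \<noteq> 0"
  by (induction n) (auto simp: prod_eq_iff zero_prod_def)

text \<open>
  The inverse map preserves the open cone of negative slopes and does not contract it,
  hence a vector that decays backwards never enters it.
\<close>

lemma backward_tangent_positive_cone:
  assumes h: "circle_map_lift h" and lim: "(growth_rate h z v \<longlongrightarrow> lam) at_bot" "0 < lam" and "v \<noteq> 0"
  shows "0 \<le> fst (backward_tangent h z v n) * snd (backward_tangent h z v n)"
proof (rule ccontr)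
  let ?v = "backward_tangent h z v"
  assume neg: "\<not> 0 \<le> fst (?v n) * snd (?v n)"
  have inv: "fst (?v (n + k)) * snd (?v (n + k)) < 0 \<and> norm (?v n) \<le> norm (?v (n + k))" for k
  proof (induction k)
    case (Suc k)
    define a b c where "a = fst (?v (n + k))" and "b = snd (?v (n + k))"
      and "c = deriv h (fst ((inv (T_lift h) ^^ Suc (n + k)) z))"
    have c: "0 \<le> c" using circle_map_lift_deriv_nonneg[OF h] by (simp add: c_def)
    have v: "fst (?v (n + Suc k)) = a - b" "snd (?v (n + Suc k)) = b - c * (a - b)"
      by (simp_all add: a_def b_def c_def)
    have ab: "a * b < 0" using Suc by (simp add: a_def b_def)
    have "(a - b)\<^sup>2 = a\<^sup>2 + b\<^sup>2 - 2 * (a * b)" by (simp add: power2_eq_square algebra_simps)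
    then have "a\<^sup>2 \<le> (a - b)\<^sup>2" using ab zero_le_power2[of b] by linarith
    moreover have "b\<^sup>2 \<le> (b - c * (a - b))\<^sup>2"
    proof -
      have "b * (a - b) = a * b - b\<^sup>2" by (simp add: power2_eq_square algebra_simps)
      then have "b * (a - b) \<le> 0" using ab zero_le_power2[of b] by linarith
      then have "c * (b * (a - b)) \<le> 0" using c by (simp add: mult_nonneg_nonpos)
      moreover have "(b - c * (a - b))\<^sup>2 = b\<^sup>2 - 2 * (c * (b * (a - b))) + (c * (a - b))\<^sup>2"
        by (simp add: power2_eq_square algebra_simps)
      ultimately show ?thesis using zero_le_power2[of "c * (a - b)"] by linarith
    qed
    ultimately have norm: "norm (?v (n + k)) \<le> norm (?v (n + Suc k))"
      unfolding norm_prod_def v a_def[symmetric] b_def[symmetric] real_norm_def power2_abs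
      by (intro real_sqrt_le_mono add_mono)
    have "(a - b) * (b - c * (a - b)) = a * b - b\<^sup>2 - c * (a - b)\<^sup>2"
      by (simp add: power2_eq_square algebra_simps)
    then have "(a - b) * (b - c * (a - b)) < 0"
      using ab mult_nonneg_nonneg[OF c zero_le_power2[of "a - b"]] zero_le_power2[of b] by linarith
    then have "fst (?v (n + Suc k)) * snd (?v (n + Suc k)) < 0" unfolding v .
    then show ?case using order_trans[OF conjunct2[OF Suc] norm] by (rule conjI)
  qed (use neg in auto)
  \<comment> \<open>From time \<open>n\<close> on the backward norms stay above
    \<open>norm (?v n)\<close>. The growth rate at negative times divides their logarithm by a
    negative number, so its limit is at most 0.\<close>
  define L where "L = ln (norm (?v n))"
  have "?v n \<noteq> 0" using backward_tangent_nonzero[OF \<open>v \<noteq> 0\<close>] .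
  then have L: "L \<le> ln (norm (?v m))" if "n \<le> m" for m
    using inv[of "m - n"] that unfolding L_def by (intro ln_mono) auto
  have "- int m \<le> Z" if "nat (- Z) \<le> m" for m Z using that by linarith
  then have "filterlim (\<lambda>m. - int m) at_bot sequentially"
    unfolding filterlim_at_bot by (blast intro: eventually_sequentiallyI)
  from filterlim_compose[OF lim(1) this]
  have "((\<lambda>m. growth_rate h z v (- int m)) \<longlonglongrightarrow> lam)" .
  moreover have "(\<lambda>m. - L / real m) \<longlonglongrightarrow> 0"
    by (intro tendsto_divide_0[OF tendsto_const] filterlim_at_top_imp_at_infinity filterlim_real_sequentially)
  moreover have "\<forall>\<^sub>F m in sequentially. growth_rate h z v (- int m) \<le> - L / real m"
    using eventually_ge_at_top[of "max 1 n"]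
  proof eventually_elim
    case (elim m)
    then show ?case using L[of m] growth_rate_backward[OF h, of m]
      by (auto intro!: divide_right_mono simp: divide_le_cancel)
  qed
  ultimately have "lam \<le> 0" using tendsto_le[OF trivial_limit_sequentially] by blast
  then show False using lim by simp
qed

lemma abs_add_same_sign:
  fixes a b :: real
  assumes "0 \<le> a * b"
  shows "\<bar>a + b\<bar> = \<bar>a\<bar> + \<bar>b\<bar>"
  using assms by (auto simp: zero_le_mult_iff)

text \<open>All backward images of \<open>v\<close> lie in the closed cone of nonnegative slopes.
  There the forward step adds absolute values without cancellation, so the quotients
  \<open>\<bar>b n\<bar> / \<bar>a n\<bar>\<close> satisfy exactly the recursion of
  \<open>slope_bound_backward_orbit\<close>.\<close>

lemma unstable_vector_slope:
  assumes h: "circle_map_lift h" and "0 \<le> A" and K: "K = 9 * A + 4"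
    and A: "\<And>x. \<bar>x\<bar> \<le> 1 \<Longrightarrow> deriv h x \<le> A * x\<^sup>2"
      "\<And>x. \<bar>x\<bar> \<le> 1 \<Longrightarrow> \<bar>h x - h 0\<bar> \<le> A * \<bar>x\<bar> ^ 3"
    and lim: "(growth_rate h z v \<longlongrightarrow> lam) at_bot" "0 < lam" and "v \<noteq> 0"
  shows "\<bar>snd v\<bar> \<le> K * parab (fst z) (snd z) * \<bar>fst v\<bar>"
proof -
  define a b where "a n = fst (backward_tangent h z v n)" and "b n = snd (backward_tangent h z v n)" for n
  define w where "w n = (inv (T_lift h) ^^ n) z" for n
  define p where "p n = deriv h (fst (w (Suc n)))" for n
  have p: "0 \<le> p n" for n using circle_map_lift_deriv_nonneg[OF h] by (simp add: p_def)
  have cone: "0 \<le> a n * b n" for n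
    unfolding a_def b_def by (rule backward_tangent_positive_cone[OF h lim \<open>v \<noteq> 0\<close>])
  have rec: "a (Suc n) = a n - b n" "b (Suc n) = b n - p n * (a n - b n)" for n
    by (simp_all add: a_def b_def p_def w_def)
  have absb: "\<bar>b n\<bar> = p n * \<bar>a (Suc n)\<bar> + \<bar>b (Suc n)\<bar>" for n
  proof -
    have "b n = p n * a (Suc n) + b (Suc n)" by (simp add: rec)
    moreover have "0 \<le> (p n * a (Suc n)) * b (Suc n)" using p[of n] cone[of "Suc n"] by (simp add: mult.assoc)
    ultimately show ?thesis using abs_add_same_sign p by (simp add: abs_mult)
  qed
  have absa: "\<bar>a n\<bar> = \<bar>a (Suc n)\<bar> + \<bar>b n\<bar>" for n
  proof -
    have "0 \<le> p n * (a (Suc n) * a (Suc n)) + a (Suc n) * b (Suc n)"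
      using p[of n] cone[of "Suc n"] by simp
    also have "\<dots> = a (Suc n) * b n" by (simp add: rec algebra_simps)
    finally show ?thesis using abs_add_same_sign[of "a (Suc n)" "b n"] by (simp add: rec)
  qed
  \<comment> \<open>If \<open>a n\<close> vanished, \<open>absa\<close> would force
    \<open>b n = 0\<close> as well, but a backward image of a nonzero vector is nonzero.\<close>
  have a0: "0 < \<bar>a n\<bar>" for n
    using absa[of n] backward_tangent_nonzero[OF \<open>v \<noteq> 0\<close>, of h z n]
    by (auto simp: a_def b_def prod_eq_iff)
  define u where "u n = \<bar>b n\<bar> / \<bar>a n\<bar>" for n
  have "u 0 \<le> K * parab (fst (w 0)) (snd (w 0))"
  proof (rule slope_bound_backward_orbit[OF h \<open>0 \<le> A\<close> K A])
    fix n
    have "T_lift h (inv (T_lift h) y) = y" for y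
      using bij_T_lift by (metis bij_is_surj surj_f_inv_f)
    then show "w n = T_lift h (w (Suc n))" by (simp add: w_def)
    show "0 \<le> u n" "u n \<le> 1" using a0[of n] absa[of n] by (simp_all add: u_def)
    show "u n = (deriv h (fst (w (Suc n))) + u (Suc n)) / (1 + deriv h (fst (w (Suc n))) + u (Suc n))"
    proof -
      define s where "s = \<bar>a (Suc n)\<bar>"
      have s: "0 < s" "\<bar>b (Suc n)\<bar> = u (Suc n) * s" using a0 by (simp_all add: s_def u_def)
      have "u n = (p n * s + u (Suc n) * s) / (s + p n * s + u (Suc n) * s)"
        unfolding u_def[of n] absa[of n] absb[of n] s_def[symmetric] s(2) by (simp add: add.assoc)
      also have "\<dots> = ((p n + u (Suc n)) * s) / ((1 + p n + u (Suc n)) * s)" by (simp add: algebra_simps)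
      also have "\<dots> = (p n + u (Suc n)) / (1 + p n + u (Suc n))" using s by simp
      finally show ?thesis by (simp add: p_def)
    qed
  qed auto
  then show ?thesis using a0[of 0] by (simp add: u_def w_def a_def b_def divide_le_eq)
qed

section \<open>From almost every point to every point\<close>

lemma torus_cell_borel: "torus_cell \<in> sets borel"
  unfolding torus_cell_def by (intro borel_Times) auto

text \<open>Almost everywhere \<open>E z\<close> is an Oseledets subspace and the slope bound
  applies. The set where the bound fails is open by continuity of the line field, and an open null
  set is empty.\<close>

lemma unstable_line_field_slope:
  assumes h: "circle_map_lift h" and E: "unstable_line_field h E"
  obtains K where "0 < K" "\<And>z v. \<bar>fst z\<bar> < 1/2 \<Longrightarrow> \<bar>snd z\<bar> < 1/2 \<Longrightarrow> v \<in> E z \<Longrightarrow>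
    \<bar>snd v\<bar> \<le> K * parab (fst z) (snd z) * \<bar>fst v\<bar>"
proof -
  obtain A where A: "0 < A"
    "\<And>x. \<bar>x\<bar> \<le> 1 \<Longrightarrow> deriv h x \<le> A * x\<^sup>2"
    "\<And>x. \<bar>x\<bar> \<le> 1 \<Longrightarrow> \<bar>h x - h 0\<bar> \<le> A * \<bar>x\<bar> ^ 3"
    using circle_map_lift_flat[OF h] by blast
  define K where "K = 9 * A + 4"
  have "\<bar>snd v\<bar> \<le> K * parab (fst z) (snd z) * \<bar>fst v\<bar>"
    if z: "\<bar>fst z\<bar> < 1/2" "\<bar>snd z\<bar> < 1/2" and v: "v \<in> E z" for z v
  proof -
    obtain U w where U: "open U" "z \<in> U" "continuous_on U w"
      "\<And>x. x \<in> U \<Longrightarrow> w x \<noteq> 0" "\<And>x. x \<in> U \<Longrightarrow> E x = span {w x}"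
      using E unfolding unstable_line_field_def continuous_line_field_def by metis
    \<comment> \<open>A negative value means that the local generator \<open>w x\<close> violates
      the bound. Scaling the vector by \<open>c\<close> multiplies the expression by
      \<open>\<bar>c\<bar>\<close>, so the generator decides for the whole line.\<close>
    define F where "F x = K * parab (fst x) (snd x) * \<bar>fst (w x)\<bar> - \<bar>snd (w x)\<bar>" for x
    \<comment> \<open>The interior of the cell keeps \<open>W\<close> open while staying inside
      \<open>torus_cell\<close>, where the almost-everywhere statement is available.\<close>
    define W where "W = U \<inter> ({-1/2<..<1/2} \<times> {-1/2<..<1/2})"
    have W: "open W" "z \<in> W" "W \<subseteq> U" "W \<subseteq> torus_cell"
      using U z by (auto simp: W_def torus_cell_def open_Times abs_less_iff mem_Times_iff)
    have contF: "continuous_on W F"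
      unfolding F_def parab_def using continuous_on_subset[OF U(3) W(3)] by (intro continuous_intros)
    have openF: "open {x \<in> W. F x < 0}"
    proof -
      have "open (F -` {..<0} \<inter> W)"
        using contF W(1) by (metis continuous_on_open_vimage open_lessThan)
      then show ?thesis by (simp add: vimage_def Int_def conj_commute)
    qed
    moreover have "negligible {x \<in> W. F x < 0}"
    proof -
      have "AE x in lborel. x \<in> torus_cell \<longrightarrow> (\<exists>lam>0. E x = oseledets_subspace h lam x)"
        using E unfolding unstable_line_field_def torus_measure_def
        by (subst (asm) AE_restrict_space_iff) (simp_all add: torus_cell_borel)
      then have "AE x in lborel. x \<notin> {x \<in> W. F x < 0}"
      proof eventually_elim
        case (elim x)
        have False if x: "x \<in> W" "F x < 0"
        proof -
          obtain lam where lam: "0 < lam" "E x = oseledets_subspace h lam x" using elim x W by blast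
          have "x \<in> U" using x W by blast
          then have "w x \<in> E x" "w x \<noteq> 0" using U(4,5) by (simp_all add: span_base)
          then have "(growth_rate h x (w x) \<longlongrightarrow> lam) at_bot"
            using lam unfolding oseledets_subspace_def by auto
          from unstable_vector_slope[OF h less_imp_le[OF A(1)] K_def A(2,3) this lam(1) \<open>w x \<noteq> 0\<close>]
          show False using x(2) by (simp add: F_def)
        qed
        then show ?case by blast
      qed
      then have "{x \<in> W. F x < 0} \<in> null_sets lborel"
        using openF by (subst AE_iff_null_sets) auto
      then have "{x \<in> W. F x < 0} \<in> null_sets lebesgue" by (rule null_sets_completionI)
      then show ?thesis by (simp add: negligible_iff_null_sets)
    qed
    ultimately have "{x \<in> W. F x < 0} = {}" using open_not_negligible by blast
    then have "z \<notin> {x \<in> W. F x < 0}" by blast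
    then have Fz: "0 \<le> F z" using W(2) by simp
    obtain c where "v = c *\<^sub>R w z" using v U by (auto simp: span_singleton)
    then have "K * parab (fst z) (snd z) * \<bar>fst v\<bar> - \<bar>snd v\<bar> = \<bar>c\<bar> * F z"
      by (simp add: F_def abs_mult algebra_simps)
    then show ?thesis using Fz by (smt (verit) mult_nonneg_nonneg abs_ge_zero)
  qed
  then show thesis using A by (intro that[of K]) (auto simp: K_def)
qed

section \<open>Integrals on the torus\<close>

lemma space_torus_measure: "space torus_measure = torus_cell"
  by (simp add: torus_measure_def space_restrict_space)

lemma emeasure_lborel_rectangle:
  fixes a b c d :: real
  assumes "a \<le> b" "c \<le> d"
  shows "emeasure lborel ({a..b} \<times> {c..d}) = ennreal ((b - a) * (d - c))"
proof -
  have "emeasure (lborel :: (real \<times> real) measure) ({a..b} \<times> {c..d}) =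
      emeasure lborel {a..b} * emeasure lborel {c..d}"
    unfolding lborel_prod[symmetric] by (rule lborel.emeasure_pair_measure_Times) auto
  then show ?thesis using assms by (simp add: ennreal_mult)
qed

lemma torus_rectangle_indicator:
  fixes a b c d :: real
  assumes "a \<le> b" "c \<le> d" "{a..b} \<times> {c..d} \<subseteq> torus_cell"
  shows "integrable torus_measure (\<lambda>z. m * indicator ({a..b} \<times> {c..d}) z)"
    and "(\<integral>z. m * indicator ({a..b} \<times> {c..d}) z \<partial>torus_measure) = m * ((b - a) * (d - c))"
proof -
  let ?R = "{a..b} \<times> {c..d}"
  have R: "?R \<in> sets torus_measure" "emeasure torus_measure ?R = ennreal ((b - a) * (d - c))"
    using assms emeasure_lborel_rectangle[of a b c d]
    by (auto simp: torus_measure_def sets_restrict_space_iff emeasure_restrict_space torus_cell_borel borel_Times)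
  then show "integrable torus_measure (\<lambda>z. m * indicator ?R z)"
    by (intro integrable_mult_right integrable_real_indicator) auto
  have "measure torus_measure ?R = (b - a) * (d - c)"
    using R assms by (simp add: measure_def)
  then show "(\<integral>z. m * indicator ?R z \<partial>torus_measure) = m * ((b - a) * (d - c))"
    using R by (simp add: space_torus_measure Int_absorb2 assms(3))
qed

text \<open>The nonnegative majorant \<open>m\<close> times an indicator is integrable. If
  \<open>F\<close> is not integrable, its integral is 0 by convention and the bound still holds,
  which is how \<open>integral_mono'\<close> argues.\<close>

lemma torus_integral_le_rectangle:
  fixes F :: "real \<times> real \<Rightarrow> real"
  assumes "a \<le> b" "c \<le> d" "{a..b} \<times> {c..d} \<subseteq> torus_cell" "0 \<le> m"
    and "\<And>z. z \<in> {a..b} \<times> {c..d} \<Longrightarrow> F z \<le> m"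
    and "\<And>z. z \<in> torus_cell \<Longrightarrow> z \<notin> {a..b} \<times> {c..d} \<Longrightarrow> F z \<le> 0"
  shows "(\<integral>z. F z \<partial>torus_measure) \<le> m * ((b - a) * (d - c))"
  unfolding torus_rectangle_indicator(2)[OF assms(1-3), symmetric]
  by (rule integral_mono'[OF torus_rectangle_indicator(1)[OF assms(1-3)]])
    (use assms in \<open>auto simp: space_torus_measure indicator_def\<close>)

lemma torus_integral_ge_rectangle:
  fixes F :: "real \<times> real \<Rightarrow> real"
  assumes "a \<le> b" "c \<le> d" "{a..b} \<times> {c..d} \<subseteq> torus_cell"
    and "continuous_on UNIV F" "\<And>z. 0 \<le> F z" "\<And>z. F z \<le> M"
    and "\<And>z. z \<in> {a..b} \<times> {c..d} \<Longrightarrow> m \<le> F z"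
  shows "m * ((b - a) * (d - c)) \<le> (\<integral>z. F z \<partial>torus_measure)"
  unfolding torus_rectangle_indicator(2)[OF assms(1-3), symmetric]
proof (rule integral_mono)
  \<comment> \<open>The torus has mass at most 1, so bounded continuous functions are
    integrable.\<close>
  have "emeasure (lborel :: (real \<times> real) measure) torus_cell \<le>
      emeasure lborel ({-1/2..1/2 :: real} \<times> {-1/2..1/2 :: real})"
    by (intro emeasure_mono) (auto simp: torus_cell_def borel_Times)
  also have "\<dots> = 1"
    using emeasure_lborel_rectangle[of "-1/2" "1/2" "-1/2" "1/2"] by simp
  finally have "emeasure torus_measure (space torus_measure) < \<infinity>"
    unfolding space_torus_measure unfolding torus_measure_def
    by (subst emeasure_restrict_space) (auto simp: torus_cell_borel intro: le_less_trans)
  then interpret finite_measure torus_measure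
    by (intro finite_measureI) auto
  show "integrable torus_measure F"
  proof (rule integrable_const_bound[of _ M])
    have "F \<in> borel_measurable borel" using assms(4) by (rule borel_measurable_continuous_onI)
    then show "F \<in> borel_measurable torus_measure"
      unfolding torus_measure_def by (intro measurable_restrict_space1) simp
  qed (use assms in auto)
qed (use assms torus_rectangle_indicator(1)[OF assms(1-3)] in \<open>auto simp: indicator_def\<close>)

section \<open>Differentiable functions in product form\<close>

lemma C1_torus_product:
  fixes p q :: "real \<Rightarrow> real"
  assumes p: "\<And>x. (p has_real_derivative p' x) (at x)" "continuous_on UNIV p'" "\<And>x. p (x + 1) = p x"
    and q: "\<And>y. (q has_real_derivative q' y) (at y)" "continuous_on UNIV q'" "\<And>y. q (y + 1) = q y"
  shows "C1_torus (\<lambda>z. p (fst z) * q (snd z))"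
    and "frechet_derivative (\<lambda>z. p (fst z) * q (snd z)) (at z) =
      (\<lambda>v. p' (fst z) * q (snd z) * fst v + p (fst z) * q' (snd z) * snd v)"
proof -
  define X Y where "X = Blinfun (fst :: real \<times> real \<Rightarrow> real)" and "Y = Blinfun (snd :: real \<times> real \<Rightarrow> real)"
  have XY: "blinfun_apply X = fst" "blinfun_apply Y = snd"
    by (simp_all add: X_def Y_def bounded_linear_Blinfun_apply bounded_linear_fst bounded_linear_snd)
  \<comment> \<open>As a combination of two fixed functionals, \<open>D\<close> is continuous in
    operator norm as soon as its scalar coefficients are continuous.\<close>
  define D where "D z = (p' (fst z) * q (snd z)) *\<^sub>R X + (p (fst z) * q' (snd z)) *\<^sub>R Y" for z
  have D: "((\<lambda>z. p (fst z) * q (snd z)) has_derivative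
      (\<lambda>v. p' (fst z) * q (snd z) * fst v + p (fst z) * q' (snd z) * snd v)) (at z)" for z
  proof -
    have "((\<lambda>z. p (fst z)) has_derivative (\<lambda>v. fst v * p' (fst z))) (at z)"
      by (rule DERIV_compose_FDERIV[where g = fst, OF p(1)]) (auto intro!: derivative_eq_intros)
    moreover have "((\<lambda>z. q (snd z)) has_derivative (\<lambda>v. snd v * q' (snd z))) (at z)"
      by (rule DERIV_compose_FDERIV[where g = snd, OF q(1)]) (auto intro!: derivative_eq_intros)
    ultimately have "((\<lambda>z. p (fst z) * q (snd z)) has_derivative
        (\<lambda>v. p (fst z) * (snd v * q' (snd z)) + fst v * p' (fst z) * q (snd z))) (at z)"
      by (rule has_derivative_mult)
    then show ?thesis by (rule has_derivative_eq_rhs) (auto simp: algebra_simps)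
  qed
  have cont: "continuous_on UNIV p" "continuous_on UNIV q"
    using p(1) q(1) DERIV_isCont by (blast intro: continuous_at_imp_continuous_on)+
  have "continuous_on UNIV D"
    unfolding D_def
    by (intro continuous_intros continuous_on_compose2[OF p(2)] continuous_on_compose2[OF q(2)]
        continuous_on_compose2[OF cont(1)] continuous_on_compose2[OF cont(2)]) auto
  moreover have "((\<lambda>z. p (fst z) * q (snd z)) has_derivative blinfun_apply (D z)) (at z)" for z
    by (rule has_derivative_eq_rhs[OF D])
      (simp add: D_def blinfun.add_left blinfun.scaleR_left XY fun_eq_iff)
  ultimately show "C1_torus (\<lambda>z. p (fst z) * q (snd z))"
    unfolding C1_torus_def torus_fun_def using p(3) q(3) by auto
  show "frechet_derivative (\<lambda>z. p (fst z) * q (snd z)) (at z) =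
      (\<lambda>v. p' (fst z) * q (snd z) * fst v + p (fst z) * q' (snd z) * snd v)"
    by (rule frechet_derivative_at[OF D, symmetric])
qed

section \<open>Estimates for the measure \<open>\<nu>\<close>\<close>

lemma nu_integral_nonneg:
  assumes "\<And>z. 0 \<le> \<phi> z"
  shows "0 \<le> nu_integral \<phi>"
  unfolding nu_integral_def set_lebesgue_integral_def
proof (intro Bochner_Integration.integral_nonneg)
  fix s :: real
  have "0 \<le> arc_length_integral \<phi> c" for c
    unfolding arc_length_integral_def set_lebesgue_integral_def
    using assms by (intro Bochner_Integration.integral_nonneg) auto
  then have "0 \<le> (\<Sum>c\<leftarrow>D_boundary s. arc_length_integral \<phi> c)" by (intro sum_list_nonneg) auto
  then show "0 \<le> indicator {0..1} s *\<^sub>R (\<Sum>c\<leftarrow>D_boundary s. arc_length_integral \<phi> c)" by simp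
qed

text \<open>This serves integrands containing the field \<open>e\<close>, whose sign may vary from
  point to point. A non-integrable integrand has integral 0 by convention, which lies below the
  nonnegative right side.\<close>

lemma set_integral_le_const:
  fixes F :: "real \<Rightarrow> real"
  assumes "a \<le> b" "0 \<le> m" "\<And>t. t \<in> {a..b} \<Longrightarrow> F t \<le> m"
  shows "(LBINT t:{a..b}. F t) \<le> m * (b - a)"
proof -
  have "integrable lborel (\<lambda>t. m * indicator {a..b} t :: real)"
    by (intro integrable_mult_right integrable_real_indicator) (use assms in auto)
  then have "(\<integral>t. indicator {a..b} t *\<^sub>R F t \<partial>lborel) \<le> (\<integral>t. m * indicator {a..b} t \<partial>lborel)"
    by (rule integral_mono') (use assms in \<open>auto simp: indicator_def\<close>)
  then show ?thesis using assms by (simp add: set_lebesgue_integral_def)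
qed

lemma arc_length_integral_linepath_le:
  assumes "0 \<le> M" "\<And>t. t \<in> {0..1} \<Longrightarrow> \<phi> (linepath a b t) \<le> M"
  shows "arc_length_integral \<phi> (linepath a b) \<le> M * dist a b"
proof -
  have v: "vector_derivative (linepath a b) (at t) = b - a" for t
    by (rule vector_derivative_at) (rule has_vector_derivative_linepath_within)
  have "arc_length_integral \<phi> (linepath a b) \<le> M * norm (b - a) * (1 - 0)"
    unfolding arc_length_integral_def v
    by (rule set_integral_le_const) (use assms in \<open>auto intro: mult_right_mono\<close>)
  then show ?thesis by (simp add: dist_norm norm_minus_commute)
qed

text \<open>Only the boundaries with parameter \<open>s \<le> r\<close> contribute. Each consists of
  four sides of length at most \<open>2 * r\<close>, and integrating \<open>8 * M * r\<close> over
  \<open>s\<close> in \<open>{0..r}\<close> gives the second factor \<open>r\<close>.\<close>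

lemma L1_nu_norm_le:
  fixes \<phi> :: "real \<times> real \<Rightarrow> real"
  assumes r: "0 < r" "r < 1/2" and "0 \<le> M"
    and le: "\<And>x y. \<bar>x\<bar> \<le> r \<Longrightarrow> \<bar>y\<bar> \<le> r\<^sup>2 \<Longrightarrow> \<bar>\<phi> (x, y)\<bar> \<le> M"
    and zero: "\<And>x y. \<bar>x\<bar> \<le> 1/2 \<Longrightarrow> \<bar>y\<bar> \<le> 1/2 \<Longrightarrow> r < \<bar>x\<bar> \<or> r\<^sup>2 < \<bar>y\<bar> \<Longrightarrow> \<phi> (x, y) = 0"
  shows "L1_nu_norm \<phi> \<le> 8 * M * r\<^sup>2"
proof -
  define J where "J s = (\<Sum>c\<leftarrow>D_boundary s. arc_length_integral (\<lambda>z. \<bar>\<phi> z\<bar>) c)" for s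
  have hor: "linepath (a, y) (b, y) t = (linepath a b t, y)"
    and ver: "linepath (y, a) (y, b) t = (y, linepath a b t)" for a b y t :: real
    by (simp_all add: linepath_def algebra_simps)
  have lp: "\<bar>linepath a b t\<bar> \<le> c" if "\<bar>a\<bar> \<le> c" "\<bar>b\<bar> \<le> c" "t \<in> {0..1}" for a b c t :: real
  proof -
    have "\<bar>linepath a b t\<bar> \<le> (1 - t) * \<bar>a\<bar> + t * \<bar>b\<bar>"
      using that by (auto simp: linepath_def abs_mult intro: order_trans[OF abs_triangle_ineq])
    also have "\<dots> \<le> (1 - t) * c + t * c" using that by (intro add_mono mult_left_mono) auto
    finally show ?thesis by (simp add: algebra_simps)
  qed
  have Jle: "J s \<le> 8 * M * r" if s: "0 \<le> s" "s \<le> r" for s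
  proof -
    have ss: "s\<^sup>2 \<le> r\<^sup>2" using s by (intro power_mono) auto
    have s2s: "s\<^sup>2 \<le> s" using s r by (simp add: power2_eq_square mult_left_le_one_le)
    have H: "arc_length_integral (\<lambda>z. \<bar>\<phi> z\<bar>) (linepath (a, y) (b, y)) \<le> M * (2 * r)"
      if "\<bar>a\<bar> = s" "\<bar>b\<bar> = s" "\<bar>y\<bar> = s\<^sup>2" for a b y
    proof -
      have "arc_length_integral (\<lambda>z. \<bar>\<phi> z\<bar>) (linepath (a, y) (b, y)) \<le> M * dist (a, y) (b, y)"
        by (rule arc_length_integral_linepath_le) (use assms(3) that s ss lp[of a s b] in \<open>force simp: hor intro!: le\<close>)+
      also have "\<dots> \<le> M * (2 * r)" using that s assms(3)
        by (intro mult_left_mono) (auto simp: dist_Pair_Pair dist_real_def)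
      finally show ?thesis .
    qed
    have V: "arc_length_integral (\<lambda>z. \<bar>\<phi> z\<bar>) (linepath (y, a) (y, b)) \<le> M * (2 * r)"
      if "\<bar>a\<bar> = s\<^sup>2" "\<bar>b\<bar> = s\<^sup>2" "\<bar>y\<bar> = s" for a b y
    proof -
      have "arc_length_integral (\<lambda>z. \<bar>\<phi> z\<bar>) (linepath (y, a) (y, b)) \<le> M * dist (y, a) (y, b)"
        by (rule arc_length_integral_linepath_le) (use assms(3) that s ss lp[of a "s\<^sup>2" b] in \<open>force simp: ver intro!: le\<close>)+
      also have "\<dots> \<le> M * (2 * r)" using that s s2s assms(3)
        by (intro mult_left_mono) (auto simp: dist_Pair_Pair dist_real_def)
      finally show ?thesis .
    qed
    have "J s = arc_length_integral (\<lambda>z. \<bar>\<phi> z\<bar>) (linepath (-s, -s\<^sup>2) (s, -s\<^sup>2)) +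
        arc_length_integral (\<lambda>z. \<bar>\<phi> z\<bar>) (linepath (s, -s\<^sup>2) (s, s\<^sup>2)) +
        arc_length_integral (\<lambda>z. \<bar>\<phi> z\<bar>) (linepath (s, s\<^sup>2) (-s, s\<^sup>2)) +
        arc_length_integral (\<lambda>z. \<bar>\<phi> z\<bar>) (linepath (-s, s\<^sup>2) (-s, -s\<^sup>2))"
      using s r by (simp add: J_def D_boundary_def)
    also have "\<dots> \<le> M * (2 * r) + M * (2 * r) + M * (2 * r) + M * (2 * r)"
      using s by (intro add_mono H V) auto
    finally show ?thesis by (simp add: algebra_simps)
  qed
  \<comment> \<open>For \<open>s > r\<close> the horizontal sides have
    \<open>\<bar>y\<bar> = s\<^sup>2 > r\<^sup>2\<close> and the vertical ones
    \<open>\<bar>x\<bar> = s > r\<close>, so every side misses the box.\<close>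
  have Jzero: "J s = 0" if s: "r < s" for s
  proof -
    have ss: "r\<^sup>2 < s\<^sup>2" using s r by (intro power_strict_mono) auto
    have Z: "arc_length_integral (\<lambda>z. \<bar>\<phi> z\<bar>) c = 0" if "\<And>t. t \<in> {0..1} \<Longrightarrow> \<phi> (c t) = 0" for c
      unfolding arc_length_integral_def
      by (subst set_lebesgue_integral_cong[where g = "\<lambda>_. 0"]) (use that in auto)
    have H: "arc_length_integral (\<lambda>z. \<bar>\<phi> z\<bar>) (linepath (a, y) (b, y)) = 0"
      if "\<bar>a\<bar> \<le> 1/2" "\<bar>b\<bar> \<le> 1/2" "\<bar>y\<bar> = s\<^sup>2" "s\<^sup>2 \<le> 1/2" for a b y
      using that ss lp[of a "1/2" b] by (intro Z) (auto simp: hor intro!: zero)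
    have V: "arc_length_integral (\<lambda>z. \<bar>\<phi> z\<bar>) (linepath (y, a) (y, b)) = 0"
      if "\<bar>a\<bar> \<le> 1/2" "\<bar>b\<bar> \<le> 1/2" "\<bar>y\<bar> = s" "s \<le> 1/2" for a b y
      using that s lp[of a "1/2" b] by (intro Z) (auto simp: ver intro!: zero)
    \<comment> \<open>The three shapes of \<open>D_boundary\<close>: a rectangle, two circles, and
      the empty boundary.\<close>
    consider "s < 1/2" "s\<^sup>2 \<le> 1/2" | "1/2 \<le> s" "s\<^sup>2 < 1/2" | "1/2 \<le> s" "1/2 \<le> s\<^sup>2"
    proof (cases "s < 1/2")
      case True
      have "s\<^sup>2 \<le> s * 1" unfolding power2_eq_square using True s r by (intro mult_left_mono) auto
      with True that show ?thesis by linarith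
    qed (use that in linarith)
    then show ?thesis
      by cases (use H V s r in \<open>auto simp: J_def D_boundary_def\<close>)
  qed
  have "L1_nu_norm \<phi> = (LBINT s:{0..1}. J s)" by (simp add: L1_nu_norm_def nu_integral_def J_def)
  also have "\<dots> = (LBINT s:{0..r}. J s)"
    unfolding set_lebesgue_integral_def
    by (rule Bochner_Integration.integral_cong) (use Jzero r in \<open>auto simp: indicator_def\<close>)
  also have "\<dots> \<le> (8 * M * r) * (r - 0)"
    by (rule set_integral_le_const) (use Jle r assms(3) in auto)
  finally show ?thesis by (simp add: power2_eq_square)
qed

section \<open>Bump functions and the orbits of small boxes\<close>

text \<open>Jordan's inequality: by concavity the sine lies above its chord between 0 and
  \<open>pi / 2\<close>.\<close>

lemma abs_sin_pi_ge:
  assumes "\<bar>x\<bar> \<le> 1/2"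
  shows "2 * \<bar>x\<bar> \<le> \<bar>sin (pi * x)\<bar>"
proof -
  have conc: "concave_on {0..pi} sin"
  proof (rule f''_le0_imp_concave)
    show "(sin has_real_derivative cos x) (at x)" "(cos has_real_derivative - sin x) (at x)" for x
      by (auto intro!: derivative_eq_intros)
  qed (auto intro: sin_ge_zero)
  have "(1 - 2 * \<bar>x\<bar>) * sin 0 + 2 * \<bar>x\<bar> * sin (pi / 2) \<le> sin ((1 - 2 * \<bar>x\<bar>) *\<^sub>R 0 + (2 * \<bar>x\<bar>) *\<^sub>R (pi / 2))"
    by (rule concave_onD[OF conc]) (use assms in auto)
  then have "2 * \<bar>x\<bar> \<le> sin (pi * \<bar>x\<bar>)" by (simp add: mult.commute)
  then show ?thesis by (cases "0 \<le> x") auto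
qed

text \<open>Squaring the positive part makes the function continuously differentiable at the ends of
  its support \<open>{-1..1}\<close>.\<close>

definition bump :: "real \<Rightarrow> real" where
  "bump t = (max 0 (1 - t\<^sup>2))\<^sup>2"

definition bump_deriv :: "real \<Rightarrow> real" where
  "bump_deriv t = - 4 * t * max 0 (1 - t\<^sup>2)"

text \<open>The error of the linear approximation is at most \<open>k\<^sup>2\<close> for every
  increment \<open>k\<close>, even when the increment crosses the kink at 0.\<close>

lemma DERIV_max_0_power2:
  "((\<lambda>u. (max 0 u)\<^sup>2) has_real_derivative 2 * max 0 u) (at (u::real))"
proof -
  have "((\<lambda>k. ((max 0 (u + k))\<^sup>2 - (max 0 u)\<^sup>2) / k - 2 * max 0 u) \<longlongrightarrow> 0) (at 0)"
  proof (rule Lim_null_comparison[where g = "\<lambda>k. \<bar>k\<bar>"])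
    have "norm (((max 0 (u + k))\<^sup>2 - (max 0 u)\<^sup>2) / k - 2 * max 0 u) \<le> \<bar>k\<bar>" if "k \<noteq> 0" for k
    proof -
      have *: "\<bar>(max 0 (u + k))\<^sup>2 - (max 0 u)\<^sup>2 - 2 * max 0 u * k\<bar> \<le> k\<^sup>2"
      proof (cases "0 \<le> u")
        case True
        show ?thesis
        proof (cases "0 \<le> u + k")
          case False
          then have "u * (u + 2 * k) \<le> 0" using True by (intro mult_nonneg_nonpos) auto
          moreover have "0 \<le> (u + k)\<^sup>2" "0 \<le> k\<^sup>2" by simp_all
          ultimately show ?thesis using True False
            by (simp add: max_def power2_eq_square algebra_simps abs_le_iff)
        qed (use True in \<open>simp add: power2_eq_square algebra_simps\<close>)
      next
        case False
        have "(max 0 (u + k))\<^sup>2 \<le> \<bar>k\<bar>\<^sup>2" using False by (intro power_mono) auto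
        then show ?thesis using False by simp
      qed
      have "((max 0 (u + k))\<^sup>2 - (max 0 u)\<^sup>2) / k - 2 * max 0 u =
          ((max 0 (u + k))\<^sup>2 - (max 0 u)\<^sup>2 - 2 * max 0 u * k) / k"
        using that by (simp add: field_simps)
      also have "norm \<dots> \<le> \<bar>k\<bar>\<^sup>2 / \<bar>k\<bar>"
        unfolding real_norm_def abs_divide by (rule divide_right_mono) (use * in simp_all)
      also have "\<dots> = \<bar>k\<bar>" unfolding power2_eq_square by (rule nonzero_mult_div_cancel_left) (simp add: that)
      finally show ?thesis .
    qed
    then show "\<forall>\<^sub>F k in at 0. norm (((max 0 (u + k))\<^sup>2 - (max 0 u)\<^sup>2) / k - 2 * max 0 u) \<le> \<bar>k\<bar>"
      by (simp add: eventually_at_filter)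
  qed (auto intro!: tendsto_eq_intros)
  then show ?thesis unfolding DERIV_def by (rule LIM_zero_cancel)
qed

lemma DERIV_bump: "(bump has_real_derivative bump_deriv t) (at t)"
proof -
  have "((\<lambda>t. 1 - t\<^sup>2) has_real_derivative - 2 * t) (at t)"
    by (auto intro!: derivative_eq_intros)
  from DERIV_chain2[OF DERIV_max_0_power2 this]
  show ?thesis unfolding bump_def[abs_def] bump_deriv_def by (simp add: mult_ac)
qed

lemma bump_bounds: "0 \<le> bump t" "bump t \<le> 1" "\<bar>bump_deriv t\<bar> \<le> 4"
proof -
  show "0 \<le> bump t" by (simp add: bump_def)
  show "bump t \<le> 1" unfolding bump_def by (rule power_le_one) auto
  show "\<bar>bump_deriv t\<bar> \<le> 4"
  proof (cases "\<bar>t\<bar> \<le> 1")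
    case True
    have "\<bar>t\<bar> * \<bar>max 0 (1 - t\<^sup>2)\<bar> \<le> 1 * 1" using True by (intro mult_mono) auto
    then show ?thesis by (simp add: bump_deriv_def abs_mult)
  next
    case False
    then have "1 < t\<^sup>2" by (metis abs_square_le_1 not_le)
    then show ?thesis by (simp add: bump_deriv_def)
  qed
qed

lemma bump_eq_0: "1 \<le> \<bar>t\<bar> \<Longrightarrow> bump t = 0" "1 \<le> \<bar>t\<bar> \<Longrightarrow> bump_deriv t = 0"
proof -
  assume "1 \<le> \<bar>t\<bar>"
  then have "1 \<le> t\<^sup>2" by (metis abs_le_square_iff abs_one one_power2)
  then show "bump t = 0" "bump_deriv t = 0" by (simp_all add: bump_def bump_deriv_def)
qed

text \<open>The sine changes sign under \<open>x + 1\<close>, and \<open>bump\<close> is even, so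
  the composition has period 1. By Jordan's inequality it vanishes on the cell wherever
  \<open>\<bar>x\<bar> > s\<close>.\<close>

definition circle_bump :: "real \<Rightarrow> real \<Rightarrow> real" where
  "circle_bump s x = bump (sin (pi * x) / s)"

definition circle_bump_deriv :: "real \<Rightarrow> real \<Rightarrow> real" where
  "circle_bump_deriv s x = bump_deriv (sin (pi * x) / s) * (pi * cos (pi * x) / s)"

lemma circle_bump_DERIV:
  "(circle_bump s has_real_derivative circle_bump_deriv s x) (at x)"
proof -
  have "((\<lambda>x. sin (pi * x) / s) has_real_derivative pi * cos (pi * x) / s) (at x)"
    by (rule DERIV_cdivide) (auto intro!: derivative_eq_intros)
  from DERIV_chain2[OF DERIV_bump this]
  show ?thesis unfolding circle_bump_def[abs_def] circle_bump_deriv_def .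
qed

lemma continuous_circle_bump_deriv: "s \<noteq> 0 \<Longrightarrow> continuous_on UNIV (circle_bump_deriv s)"
  unfolding circle_bump_deriv_def[abs_def] bump_deriv_def by (intro continuous_intros) auto

lemma circle_bump_plus_1: "circle_bump s (x + 1) = circle_bump s x"
  by (simp add: circle_bump_def bump_def distrib_left)

lemma circle_bump_plus_int: "circle_bump s (x + of_int i) = circle_bump s x"
proof -
  interpret periodic_fun_simple' "circle_bump s" by unfold_locales (rule circle_bump_plus_1)
  show ?thesis by (rule plus_of_int)
qed

lemma circle_bump_bounds:
  "0 \<le> circle_bump s x" "circle_bump s x \<le> 1"
  "0 < s \<Longrightarrow> \<bar>circle_bump_deriv s x\<bar> \<le> 16 / s"
proof -
  show "0 \<le> circle_bump s x" "circle_bump s x \<le> 1" by (simp_all add: circle_bump_def bump_bounds)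
  assume s: "0 < s"
  have "\<bar>pi * cos (pi * x) / s\<bar> \<le> 4 / s"
  proof -
    have "pi * \<bar>cos (pi * x)\<bar> \<le> 4 * 1" using pi_less_4 by (intro mult_mono) auto
    then show ?thesis using s by (simp add: abs_mult divide_right_mono)
  qed
  then have "\<bar>circle_bump_deriv s x\<bar> \<le> 4 * (4 / s)"
    unfolding circle_bump_deriv_def abs_mult by (intro mult_mono bump_bounds) auto
  then show "\<bar>circle_bump_deriv s x\<bar> \<le> 16 / s" by simp
qed

lemma circle_bump_eq_0:
  assumes "0 < s" "\<bar>x\<bar> \<le> 1/2" "s < \<bar>x\<bar>"
  shows "circle_bump s x = 0" "circle_bump_deriv s x = 0"
proof -
  have "1 \<le> \<bar>sin (pi * x) / s\<bar>" using abs_sin_pi_ge[OF assms(2)] assms by (simp add: abs_divide)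
  then show "circle_bump s x = 0" "circle_bump_deriv s x = 0"
    by (simp_all add: circle_bump_def circle_bump_deriv_def bump_eq_0)
qed

lemma abs_sin_pi_le: "\<bar>sin (pi * x)\<bar> \<le> 4 * \<bar>x\<bar>"
proof -
  have "\<bar>sin (pi * x)\<bar> \<le> pi * \<bar>x\<bar>" using abs_sin_x_le_abs_x[of "pi * x"] by (simp add: abs_mult)
  also have "\<dots> \<le> 4 * \<bar>x\<bar>" using pi_less_4 by (intro mult_right_mono) auto
  finally show ?thesis .
qed

text \<open>From \<open>\<bar>sin (pi * x)\<bar> \<le> 4 * \<bar>x\<bar>\<close> the argument of
  \<open>bump\<close> is at most 1/2, where \<open>bump\<close> is at least
  \<open>(3/4)\<^sup>2\<close>.\<close>

lemma circle_bump_ge: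
  assumes "0 < s" "\<bar>x\<bar> \<le> s / 8"
  shows "1/2 \<le> circle_bump s x"
proof -
  define t where "t = sin (pi * x) / s"
  have "\<bar>t\<bar> \<le> 1/2" using abs_sin_pi_le[of x] assms by (simp add: t_def abs_divide divide_le_eq)
  then have "\<bar>t\<bar>\<^sup>2 \<le> (1/2)\<^sup>2" by (intro power_mono) auto
  then have "3/4 \<le> max 0 (1 - t\<^sup>2)" by (simp add: power_divide)
  then have "(3/4)\<^sup>2 \<le> (max 0 (1 - t\<^sup>2))\<^sup>2" by (rule power_mono) simp
  then show ?thesis by (simp add: circle_bump_def bump_def t_def power_divide)
qed

lemma circle_bump_support:
  assumes "0 < s" "circle_bump s x \<noteq> 0"
  obtains i :: int where "\<bar>x - of_int i\<bar> \<le> s"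
proof -
  obtain i :: int where "x + of_int i \<in> {-1/2<..1/2}" using int_shift_ex by blast
  then have i: "\<bar>x + of_int i\<bar> \<le> 1/2" unfolding greaterThanAtMost_iff by linarith
  then have "\<bar>x + of_int i\<bar> \<le> s"
    using circle_bump_eq_0(1)[OF assms(1) i] assms(2) circle_bump_plus_int[of s x i] by fastforce
  then show thesis using that[of "- i"] by simp
qed

text \<open>While the orbit stays in the doubled box, the second coordinate drifts by at most
  \<open>A * (2 * r) ^ 3\<close> per step and the first by at most \<open>2 * r\<^sup>2\<close>. As
  \<open>real n * r\<close> is bounded, the total drifts over \<open>n\<close> steps are at most
  \<open>r\<^sup>2\<close> and \<open>r\<close>. The integers follow the orbit through the
  plane.\<close>

lemma T_lift_orbit_box:
  assumes h: "circle_map_lift h" and "0 < A"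
    and A: "\<And>x. \<bar>x\<bar> \<le> 1 \<Longrightarrow> \<bar>h x - h 0\<bar> \<le> A * \<bar>x\<bar> ^ 3"
    and r: "0 < r" "r \<le> 1/2" "8 * A * (real n * r) \<le> 1" "2 * (real n * r) \<le> 1"
    and start: "\<bar>fst w - of_int i\<bar> \<le> r" "\<bar>snd w - of_int j\<bar> \<le> r\<^sup>2"
  obtains i' j' :: int where "\<bar>fst ((T_lift h ^^ n) w) - of_int i'\<bar> \<le> 2 * r"
    "\<bar>snd ((T_lift h ^^ n) w) - of_int j'\<bar> \<le> 2 * r\<^sup>2"
proof -
  have "\<exists>i' j' :: int. \<bar>fst ((T_lift h ^^ k) w) - of_int i'\<bar> \<le> r + real k * (2 * r\<^sup>2) \<and>
      \<bar>snd ((T_lift h ^^ k) w) - of_int j'\<bar> \<le> r\<^sup>2 + real k * (8 * A * r ^ 3)" if "k \<le> n" for k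
    using that
  proof (induction k)
    case 0
    then show ?case using start by auto
  next
    case (Suc k)
    obtain x y where z: "(T_lift h ^^ k) w = (x, y)" by fastforce
    then obtain i j :: int where x: "\<bar>x - of_int i\<bar> \<le> r + real k * (2 * r\<^sup>2)"
      and y: "\<bar>y - of_int j\<bar> \<le> r\<^sup>2 + real k * (8 * A * r ^ 3)"
      using Suc by auto
    have kr: "real k * r \<le> real n * r" using Suc r by (intro mult_right_mono) auto
    have Skr: "real (Suc k) * r \<le> real n * r" using Suc.prems r by (intro mult_right_mono) auto
    have "2 * (real k * r) \<le> 1" using kr r by linarith
    then have "(2 * (real k * r)) * r \<le> 1 * r" using r by (intro mult_right_mono) simp_all
    then have x2r: "\<bar>x - of_int i\<bar> \<le> 2 * r" using x by (simp add: power2_eq_square mult_ac)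
    obtain m where m: "h (x - of_int i + of_int i) - h (x - of_int i) = of_int m"
      using circle_map_lift_add_int[OF h] by (metis Ints_cases)
    obtain m0 where m0: "h 0 = of_int m0"
      using h unfolding circle_map_lift_def by (metis Ints_cases)
    define H where "H = h (x - of_int i) - h 0"
    have "\<bar>H\<bar> \<le> A * \<bar>x - of_int i\<bar> ^ 3" unfolding H_def using A x2r r by auto
    also have "\<dots> \<le> A * (2 * r) ^ 3" using x2r \<open>0 < A\<close> by (intro mult_left_mono power_mono) auto
    finally have Hr: "\<bar>H\<bar> \<le> 8 * A * r ^ 3" by (simp add: power_mult_distrib)
    have hx: "h x = H + of_int m + of_int m0" using m m0 by (simp add: H_def)
    have z': "(T_lift h ^^ Suc k) w = (x + h x + y, h x + y)" using z by (simp add: T_lift_def)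
    have y': "\<bar>(h x + y) - of_int (j + m + m0)\<bar> \<le> r\<^sup>2 + real (Suc k) * (8 * A * r ^ 3)"
      using y Hr hx by (simp add: algebra_simps)
    have "(8 * A * (real (Suc k) * r)) * r\<^sup>2 \<le> 1 * r\<^sup>2"
    proof (rule mult_right_mono)
      have "8 * A * (real (Suc k) * r) \<le> 8 * A * (real n * r)" using Skr \<open>0 < A\<close> by (intro mult_left_mono) auto
      then show "8 * A * (real (Suc k) * r) \<le> 1" using r by linarith
    qed simp
    then have "real (Suc k) * (8 * A * r ^ 3) \<le> r\<^sup>2" by (simp add: power2_eq_square power3_eq_cube mult_ac)
    then have "\<bar>(h x + y) - of_int (j + m + m0)\<bar> \<le> 2 * r\<^sup>2" using y' by linarith
    \<comment> \<open>The first coordinate increases by the new second coordinate, so the bound just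
      obtained for the latter is the increment.\<close>
    then have x': "\<bar>(x + h x + y) - of_int (i + j + m + m0)\<bar> \<le> r + real (Suc k) * (2 * r\<^sup>2)"
      using x by (simp add: algebra_simps)
    show ?case
      unfolding z' fst_conv snd_conv
      by (rule exI[of _ "i + j + m + m0"], rule exI[of _ "j + m + m0"]) (rule conjI[OF x' y'])
  qed
  from this[OF order_refl] obtain i' j' :: int
    where i': "\<bar>fst ((T_lift h ^^ n) w) - of_int i'\<bar> \<le> r + real n * (2 * r\<^sup>2)"
      and j': "\<bar>snd ((T_lift h ^^ n) w) - of_int j'\<bar> \<le> r\<^sup>2 + real n * (8 * A * r ^ 3)"
    by blast
  have "(2 * (real n * r)) * r \<le> 1 * r" "(8 * A * (real n * r)) * r\<^sup>2 \<le> 1 * r\<^sup>2"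
    using r by (intro mult_right_mono; simp)+
  then have "r + real n * (2 * r\<^sup>2) \<le> 2 * r" "r\<^sup>2 + real n * (8 * A * r ^ 3) \<le> 2 * r\<^sup>2"
    by (simp_all add: power2_eq_square power3_eq_cube mult_ac)
  then show thesis using that i' j' by (meson order_trans)
qed

lemma funpow_inv_cancel:
  fixes f :: "'a \<Rightarrow> 'a"
  assumes "bij f"
  shows "(f ^^ n) ((inv f ^^ n) z) = z"
proof (induction n)
  case (Suc n)
  have "(f ^^ Suc n) ((inv f ^^ Suc n) z) = (f ^^ n) (f (inv f ((inv f ^^ n) z)))"
    by (simp add: funpow_swap1)
  then show ?case using Suc assms by (simp add: bij_is_surj surj_f_inv_f)
qed simp

section \<open>The test functions\<close>

definition test_f :: "real \<Rightarrow> real \<times> real \<Rightarrow> real" where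
  "test_f r z = circle_bump r (fst z) * circle_bump (r\<^sup>2) (snd z)"

definition test_g :: "real \<times> real \<Rightarrow> real" where
  "test_g z = (sin (pi * fst z))\<^sup>2"

lemma C1_torus_test_f: "0 < r \<Longrightarrow> C1_torus (test_f r)"
  unfolding test_f_def[abs_def]
  by (intro C1_torus_product(1)[OF circle_bump_DERIV _ circle_bump_plus_1 circle_bump_DERIV _ circle_bump_plus_1]
      continuous_circle_bump_deriv) auto

lemma frechet_derivative_test_f:
  "0 < r \<Longrightarrow> frechet_derivative (test_f r) (at z) =
    (\<lambda>v. circle_bump_deriv r (fst z) * circle_bump (r\<^sup>2) (snd z) * fst v +
         circle_bump r (fst z) * circle_bump_deriv (r\<^sup>2) (snd z) * snd v)"
  unfolding test_f_def[abs_def]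
  by (intro C1_torus_product(2)[OF circle_bump_DERIV _ circle_bump_plus_1 circle_bump_DERIV _ circle_bump_plus_1]
      continuous_circle_bump_deriv) auto

lemma test_f_bounds: "0 \<le> test_f r z" "test_f r z \<le> 1"
  using circle_bump_bounds by (auto simp: test_f_def intro!: mult_le_one)

lemma test_g_bounds: "0 \<le> test_g z" "test_g z \<le> 1" "test_g z \<le> 16 * (fst z)\<^sup>2"
proof -
  show "0 \<le> test_g z" by (simp add: test_g_def)
  show "test_g z \<le> 1" by (simp add: test_g_def abs_square_le_1)
  have "\<bar>sin (pi * fst z)\<bar>\<^sup>2 \<le> (4 * \<bar>fst z\<bar>)\<^sup>2" using abs_sin_pi_le by (intro power_mono) auto
  then show "test_g z \<le> 16 * (fst z)\<^sup>2" by (simp add: test_g_def power_mult_distrib)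
qed

lemma test_g_C1:
  "C1_torus test_g"
  "frechet_derivative test_g (at z) = (\<lambda>v. 2 * pi * (sin (pi * fst z) * cos (pi * fst z)) * fst v)"
proof -
  define g' where "g' x = 2 * pi * (sin (pi * x) * cos (pi * x))" for x
  have g: "((\<lambda>x. (sin (pi * x))\<^sup>2) has_real_derivative g' x) (at x)" for x
    unfolding g'_def by (auto intro!: derivative_eq_intros)
  have c: "continuous_on UNIV g'" unfolding g'_def by (intro continuous_intros)
  have p: "(sin (pi * (x + 1)))\<^sup>2 = (sin (pi * x))\<^sup>2" for x :: real by (simp add: distrib_left)
  note P = C1_torus_product[OF g c p DERIV_const[of 1] continuous_on_const refl]
  show "C1_torus test_g" using P(1) by (simp add: test_g_def[abs_def])
  show "frechet_derivative test_g (at z) = (\<lambda>v. 2 * pi * (sin (pi * fst z) * cos (pi * fst z)) * fst v)"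
    using P(2)[of z] by (simp add: test_g_def[abs_def] g'_def)
qed

lemma C1_norm_test_g: "0 \<le> C1_norm test_g" "C1_norm test_g \<le> 9"
proof -
  let ?D = "\<lambda>z. frechet_derivative test_g (at z)"
  have bl: "bounded_linear (?D z)" for z
    unfolding test_g_C1(2) by (intro bounded_linear_mult_right[THEN bounded_linear_compose] bounded_linear_fst)
  have on: "onorm (?D z) \<le> 8" for z
  proof (rule onorm_bound)
    fix v :: "real \<times> real"
    have "\<bar>sin (pi * fst z)\<bar> * \<bar>cos (pi * fst z)\<bar> \<le> 1 * 1" by (intro mult_mono) auto
    then have "(2 * pi) * (\<bar>sin (pi * fst z)\<bar> * \<bar>cos (pi * fst z)\<bar>) * \<bar>fst v\<bar> \<le> 8 * 1 * norm v"
      using pi_less_4 norm_fst_le[of "fst v" "snd v"] by (intro mult_mono) auto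
    then show "norm (?D z v) \<le> 8 * norm v" by (simp add: test_g_C1(2) abs_mult)
  qed simp
  \<comment> \<open>The supremum of a real set dominates its elements only if the set is bounded
    above, so the lower bound for \<open>C1_norm\<close> also relies on upper bounds.\<close>
  have bdd: "bdd_above (range (\<lambda>z. \<bar>test_g z\<bar>))"
    by (rule bdd_aboveI2[where M = 1]) (simp add: test_g_bounds)
  have bdd': "bdd_above (range (\<lambda>z. onorm (?D z)))"
    by (rule bdd_aboveI2[where M = 8]) (rule on)
  have "0 \<le> (SUP z. \<bar>test_g z\<bar>)" by (rule cSUP_upper2[OF bdd, of 0]) auto
  moreover have "0 \<le> (SUP z. onorm (?D z))"
    by (rule cSUP_upper2[OF bdd', of 0]) (auto intro: onorm_pos_le bl)
  ultimately show "0 \<le> C1_norm test_g" unfolding C1_norm_def by linarith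
  have "(SUP z. \<bar>test_g z\<bar>) \<le> 1" using test_g_bounds by (intro cSUP_least) auto
  moreover have "(SUP z. onorm (?D z)) \<le> 8" using on by (intro cSUP_least) auto
  ultimately show "C1_norm test_g \<le> 9" unfolding C1_norm_def by linarith
qed

section \<open>Integrals of the test functions and their correlation\<close>

lemma integral_test_f_ge:
  assumes "0 < r" "r \<le> 1/8"
  shows "r ^ 3 / 64 \<le> (\<integral>z. test_f r z \<partial>torus_measure)"
proof -
  have r2: "r\<^sup>2 \<le> 1/8" using power_mono[of r "1/8" 2] assms by (simp add: power_divide)
  have cont: "continuous_on UNIV (test_f r)"
    using C1_torus_test_f[OF assms(1)] unfolding C1_torus_def
    by (meson continuous_at_imp_continuous_on has_derivative_continuous)
  \<comment> \<open>By \<open>circle_bump_ge\<close> both factors are at least 1/2 on the box shrunk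
    by the factor 8.\<close>
  have "1/4 * ((r / 8 - - r / 8) * (r\<^sup>2 / 8 - - r\<^sup>2 / 8)) \<le> (\<integral>z. test_f r z \<partial>torus_measure)"
  proof (rule torus_integral_ge_rectangle[OF _ _ _ cont, where M = 1])
    fix z assume z: "z \<in> {- r / 8..r / 8} \<times> {- r\<^sup>2 / 8..r\<^sup>2 / 8}"
    have "1/2 * (1/2) \<le> test_f r z"
      unfolding test_f_def
      by (intro mult_mono circle_bump_ge) (use z assms circle_bump_bounds in auto)
    then show "1/4 \<le> test_f r z" by simp
  qed (use assms r2 test_f_bounds in \<open>auto simp: torus_cell_def\<close>)
  then show ?thesis by (simp add: power2_eq_square power3_eq_cube)
qed

lemma integral_test_g_ge: "1/32 \<le> (\<integral>z. test_g z \<partial>torus_measure)"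
proof -
  have cont: "continuous_on UNIV test_g"
    unfolding test_g_def[abs_def] by (intro continuous_intros)
  have "1/4 * ((1/2 - 1/4) * (1/2 - 0)) \<le> (\<integral>z. test_g z \<partial>torus_measure)"
  proof (rule torus_integral_ge_rectangle[OF _ _ _ cont, where M = 1])
    fix z :: "real \<times> real" assume z: "z \<in> {1/4..1/2} \<times> {0..1/2}"
    then have "1/2 \<le> \<bar>sin (pi * fst z)\<bar>" using abs_sin_pi_ge[of "fst z"] by auto
    then have "(1/2)\<^sup>2 \<le> \<bar>sin (pi * fst z)\<bar>\<^sup>2" by (intro power_mono) auto
    then show "1/4 \<le> test_g z" by (simp add: test_g_def power2_eq_square)
  qed (use test_g_bounds in \<open>auto simp: torus_cell_def\<close>)
  then show ?thesis by simp
qed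

text \<open>The function \<open>test_f r\<close> composed with the backward iterate lives, within
  the cell, on the doubled box, of area \<open>16 * r ^ 3\<close>; there \<open>test_g\<close> is at
  most \<open>16 * (2 * r)\<^sup>2\<close>.\<close>

lemma integral_correlation_le:
  assumes h: "circle_map_lift h" and "0 < A"
    and A: "\<And>x. \<bar>x\<bar> \<le> 1 \<Longrightarrow> \<bar>h x - h 0\<bar> \<le> A * \<bar>x\<bar> ^ 3"
    and r: "0 < r" "r \<le> 1/8" "8 * A * (real n * r) \<le> 1" "2 * (real n * r) \<le> 1" and "1 \<le> n"
  shows "(\<integral>z. test_f r (T_pow h (- int n) z) * test_g z \<partial>torus_measure) \<le> 1024 * r ^ 5"
proof -
  have r2: "r\<^sup>2 \<le> 1/8" using power_mono[of r "1/8" 2] r by (simp add: power_divide)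
  \<comment> \<open>A point of the cell within 1/4 of an integer is closer than 1 to both 0 and that
    integer in total, so the integer is 0.\<close>
  have near_0: "\<bar>t\<bar> \<le> s" if "t \<in> {-1/2<..1/2}" "\<bar>t - of_int i\<bar> \<le> s" "s \<le> 1/4" for t s :: real and i :: int
  proof -
    have "i = 0" by (rule int_between) (use that in auto)
    with that show ?thesis by simp
  qed
  have "(\<integral>z. test_f r (T_pow h (- int n) z) * test_g z \<partial>torus_measure) \<le>
      64 * r\<^sup>2 * ((2 * r - - (2 * r)) * (2 * r\<^sup>2 - - (2 * r\<^sup>2)))"
  proof (rule torus_integral_le_rectangle)
    fix z assume z: "z \<in> {- (2 * r)..2 * r} \<times> {- (2 * r\<^sup>2)..2 * r\<^sup>2}"
    have "test_f r (T_pow h (- int n) z) * test_g z \<le> 1 * test_g z"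
      using test_f_bounds test_g_bounds by (intro mult_right_mono) auto
    also have "\<dots> \<le> 16 * \<bar>fst z\<bar>\<^sup>2" using test_g_bounds(3)[of z] by simp
    also have "\<dots> \<le> 16 * (2 * r)\<^sup>2" using z by (intro mult_left_mono power_mono) auto
    finally show "test_f r (T_pow h (- int n) z) * test_g z \<le> 64 * r\<^sup>2" by (simp add: power_mult_distrib)
  next
    fix z assume z: "z \<in> torus_cell" "z \<notin> {- (2 * r)..2 * r} \<times> {- (2 * r\<^sup>2)..2 * r\<^sup>2}"
    define w where "w = (inv (T_lift h) ^^ n) z"
    have w: "T_pow h (- int n) z = w" using \<open>1 \<le> n\<close> by (simp add: T_pow_def w_def)
    have zw: "(T_lift h ^^ n) w = z" unfolding w_def by (rule funpow_inv_cancel[OF bij_T_lift])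
    have "test_f r w = 0"
    proof (rule ccontr)
      assume "test_f r w \<noteq> 0"
      then have nz: "circle_bump r (fst w) \<noteq> 0" "circle_bump (r\<^sup>2) (snd w) \<noteq> 0"
        by (auto simp: test_f_def)
      obtain i :: int where i: "\<bar>fst w - of_int i\<bar> \<le> r"
        using circle_bump_support[OF r(1) nz(1)] .
      obtain j :: int where j: "\<bar>snd w - of_int j\<bar> \<le> r\<^sup>2"
        by (rule circle_bump_support[OF _ nz(2)]) (use r in auto)
      have "r \<le> 1/2" using r by simp
      then obtain i' j' :: int where z': "\<bar>fst z - of_int i'\<bar> \<le> 2 * r" "\<bar>snd z - of_int j'\<bar> \<le> 2 * r\<^sup>2"
        using T_lift_orbit_box[OF h \<open>0 < A\<close> A r(1) _ r(3,4) i j] zw by metis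
      have cell: "fst z \<in> {-1/2<..1/2}" "snd z \<in> {-1/2<..1/2}"
        using z(1) by (simp_all add: torus_cell_def mem_Times_iff)
      have "\<bar>fst z\<bar> \<le> 2 * r" by (rule near_0[OF cell(1) z'(1)]) (use r in simp)
      moreover have "\<bar>snd z\<bar> \<le> 2 * r\<^sup>2" by (rule near_0[OF cell(2) z'(2)]) (use r2 in simp)
      ultimately show False using z(2) by (auto simp: mem_Times_iff abs_le_iff)
    qed
    then show "test_f r (T_pow h (- int n) z) * test_g z \<le> 0" by (simp add: w)
  qed (use r r2 in \<open>auto simp: torus_cell_def\<close>)
  also have "\<dots> = 1024 * r ^ 5" by (simp add: power2_eq_square eval_nat_numeral)
  finally show ?thesis .
qed

text \<open>
  The factor \<open>1 / r\<^sup>2\<close> lost by the derivative in the second coordinate is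
  compensated by the slope \<open>O(r)\<close> of the unstable direction on the support.
\<close>

lemma L1_nu_norm_deriv_along_test_f:
  assumes r: "0 < r" "r \<le> 1/8" and "0 < K" and e: "unit_tangent_field E e"
    and K: "\<And>z v. \<bar>fst z\<bar> < 1/2 \<Longrightarrow> \<bar>snd z\<bar> < 1/2 \<Longrightarrow> v \<in> E z \<Longrightarrow>
      \<bar>snd v\<bar> \<le> K * parab (fst z) (snd z) * \<bar>fst v\<bar>"
  shows "L1_nu_norm (deriv_along e (test_f r)) \<le> 8 * (16 + 32 * K) * r"
proof -
  \<comment> \<open>The first coordinate contributes \<open>16 / r\<close>, the second
    \<open>16 / r\<^sup>2\<close> times the bound \<open>2 * K * r\<close> for the vertical
    component of \<open>e\<close>.\<close>
  define M where "M = (16 + 32 * K) / r"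
  note bb = circle_bump_bounds
  have r2: "r\<^sup>2 \<le> 1/8" using power_mono[of r "1/8" 2] r by (simp add: power_divide)
  have r2': "0 < r\<^sup>2" using r by simp
  have d: "deriv_along e (test_f r) (x, y) =
      circle_bump_deriv r x * circle_bump (r\<^sup>2) y * fst (e (x, y)) +
      circle_bump r x * circle_bump_deriv (r\<^sup>2) y * snd (e (x, y))" for x y
    by (simp add: deriv_along_def frechet_derivative_test_f[OF r(1)])
  have "L1_nu_norm (deriv_along e (test_f r)) \<le> 8 * M * r\<^sup>2"
  proof (rule L1_nu_norm_le)
    fix x y assume xy: "\<bar>x\<bar> \<le> r" "\<bar>y\<bar> \<le> r\<^sup>2"
    have e1: "\<bar>fst (e (x, y))\<bar> \<le> 1"
      using e norm_fst_le[of "fst (e (x, y))" "snd (e (x, y))"] by (simp add: unit_tangent_field_def)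
    have "\<bar>snd (e (x, y))\<bar> \<le> K * parab x y * \<bar>fst (e (x, y))\<bar>"
      using K[of "(x, y)" "e (x, y)"] xy r r2 e by (simp add: unit_tangent_field_def)
    also have "\<dots> \<le> K * (2 * r) * 1"
    proof (intro mult_mono)
      have "\<bar>x\<bar>\<^sup>2 \<le> r\<^sup>2" using xy by (intro power_mono) auto
      then have "x\<^sup>2 + \<bar>y\<bar> \<le> (2 * r)\<^sup>2" using xy r2' by (simp add: power_mult_distrib)
      then show "parab x y \<le> 2 * r" using r by (intro parab_le) auto
    qed (use e1 \<open>0 < K\<close> r in \<open>auto simp: parab_def\<close>)
    finally have e2: "\<bar>snd (e (x, y))\<bar> \<le> 2 * K * r" by simp
    have "\<bar>deriv_along e (test_f r) (x, y)\<bar> \<le>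
        \<bar>circle_bump_deriv r x\<bar> * \<bar>circle_bump (r\<^sup>2) y\<bar> * \<bar>fst (e (x, y))\<bar> +
        \<bar>circle_bump r x\<bar> * \<bar>circle_bump_deriv (r\<^sup>2) y\<bar> * \<bar>snd (e (x, y))\<bar>"
      unfolding d abs_mult[symmetric] by (rule abs_triangle_ineq)
    also have "\<dots> \<le> 16 / r * 1 * 1 + 1 * (16 / r\<^sup>2) * (2 * K * r)"
      using e1 e2 r r2' bb \<open>0 < K\<close> by (intro add_mono mult_mono) auto
    also have "\<dots> = M" using r by (simp add: M_def power2_eq_square field_simps)
    finally show "\<bar>deriv_along e (test_f r) (x, y)\<bar> \<le> M" .
  next
    fix x y :: real
    assume "\<bar>x\<bar> \<le> 1/2" "\<bar>y\<bar> \<le> 1/2" "r < \<bar>x\<bar> \<or> r\<^sup>2 < \<bar>y\<bar>"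
    then show "deriv_along e (test_f r) (x, y) = 0"
      using circle_bump_eq_0[OF r(1), of x] circle_bump_eq_0[OF r2', of y] by (auto simp: d)
  qed (use r \<open>0 < K\<close> in \<open>auto simp: M_def\<close>)
  also have "\<dots> = 8 * (16 + 32 * K) * r" using r by (simp add: M_def power2_eq_square)
  finally show ?thesis .
qed

lemma L1_nu_norm_test_f:
  assumes r: "0 < r" "r \<le> 1/8"
  shows "L1_nu_norm (test_f r) \<le> 8 * r\<^sup>2"
proof -
  have r2: "0 < r\<^sup>2" using r by simp
  have "L1_nu_norm (test_f r) \<le> 8 * 1 * r\<^sup>2"
  proof (rule L1_nu_norm_le)
    fix x y :: real
    show "\<bar>test_f r (x, y)\<bar> \<le> 1" using test_f_bounds[of r "(x, y)"] by simp
    assume "\<bar>x\<bar> \<le> 1/2" "\<bar>y\<bar> \<le> 1/2" "r < \<bar>x\<bar> \<or> r\<^sup>2 < \<bar>y\<bar>"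
    then show "test_f r (x, y) = 0"
      using circle_bump_eq_0(1)[OF r(1), of x] circle_bump_eq_0(1)[OF r2, of y] by (auto simp: test_f_def)
  qed (use r in auto)
  then show ?thesis by simp
qed

section \<open>Choice of the scale and comparison of the two sides\<close>

theorem lemma10p1:
  fixes h :: "real \<Rightarrow> real"
    and E :: "real \<times> real \<Rightarrow> (real \<times> real) set"
    and e :: "real \<times> real \<Rightarrow> real \<times> real"
    and \<gamma> :: "nat \<Rightarrow> real"
  assumes "circle_map_lift h"
    and "unstable_line_field h E"
    and "unit_tangent_field E e"
    and "\<And>f g n. C1_torus f \<Longrightarrow> C1_torus g \<Longrightarrow> 1 \<le> n \<Longrightarrow>
      \<bar>(\<integral>z. f (T_pow h (- int n) z) * g z \<partial>torus_measure)
         - (\<integral>z. f z \<partial>torus_measure) * (\<integral>z. g z \<partial>torus_measure)\<bar>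
      \<le> (L1_nu_norm (deriv_along e f) + L1_nu_norm f) * C1_norm g * \<gamma> n"
  shows "\<exists>C>0. \<forall>n\<ge>1. \<gamma> n \<ge> C / (real n)\<^sup>2"
proof -
  obtain A where A: "0 < A" "\<And>x. \<bar>x\<bar> \<le> 1 \<Longrightarrow> \<bar>h x - h 0\<bar> \<le> A * \<bar>x\<bar> ^ 3"
    using circle_map_lift_flat[OF assms(1)] by blast
  obtain K where K: "0 < K" "\<And>z v. \<bar>fst z\<bar> < 1/2 \<Longrightarrow> \<bar>snd z\<bar> < 1/2 \<Longrightarrow> v \<in> E z \<Longrightarrow>
      \<bar>snd v\<bar> \<le> K * parab (fst z) (snd z) * \<bar>fst v\<bar>"
    using unstable_line_field_slope[OF assms(1,2)] by blast
  \<comment> \<open>With \<open>r = c / real n\<close> this value meets the drift conditions of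
    \<open>T_lift_orbit_box\<close>, and \<open>r \<le> 1 / 2048\<close> makes the correlation at
    most half of the lower bound for the product of the integrals.\<close>
  define c where "c = 1 / (2048 * (1 + A))"
  \<comment> \<open>The constant collects 4096 from the lower bound,
    \<open>8 * (17 + 32 * K)\<close> from the two \<open>\<nu>\<close>-norms and 9 from
    \<open>C1_norm test_g\<close>: \<open>294912 = 4096 * 8 * 9\<close>.\<close>
  define B where "B = 294912 * (17 + 32 * K)"
  have c: "0 < c" "c \<le> 1 / 2048" "8 * A * c \<le> 1" "2 * c \<le> 1"
    using A(1) by (auto simp: c_def field_simps)
  have B: "0 < B" using K(1) by (simp add: B_def)
  have "c\<^sup>2 / B / (real n)\<^sup>2 \<le> \<gamma> n" if n: "1 \<le> n" for n
  proof -
    define r where "r = c / real n"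
    have nr: "real n * r = c" and r0: "0 < r" using n c by (simp_all add: r_def)
    have "1 * r \<le> real n * r" using n r0 by (intro mult_right_mono) auto
    then have r: "r \<le> 1 / 2048" using nr c by linarith
    define I where "I = (\<integral>z. test_f r (T_pow h (- int n) z) * test_g z \<partial>torus_measure)"
    define J where "J = (\<integral>z. test_f r z \<partial>torus_measure) * (\<integral>z. test_g z \<partial>torus_measure)"
    define N where "N = L1_nu_norm (deriv_along e (test_f r)) + L1_nu_norm (test_f r)"
    have "I \<le> 1024 * r ^ 5"
      unfolding I_def
      by (rule integral_correlation_le[OF assms(1) A]) (use r0 r nr c n in simp_all)
    also have "\<dots> = 1024 * r\<^sup>2 * r ^ 3" by (simp add: eval_nat_numeral)
    also have "\<dots> \<le> 1 / 4096 * r ^ 3"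
    proof (rule mult_right_mono)
      have "r\<^sup>2 \<le> (1 / 2048)\<^sup>2" using r r0 by (intro power_mono) auto
      then show "1024 * r\<^sup>2 \<le> 1 / 4096" by (simp add: power_divide)
    qed (use r0 in simp)
    finally have I: "I \<le> r ^ 3 / 4096" by simp
    have If: "r ^ 3 / 64 \<le> (\<integral>z. test_f r z \<partial>torus_measure)"
      by (rule integral_test_f_ge) (use r0 r in simp_all)
    have "0 \<le> r ^ 3 / 64" using r0 by simp
    then have "r ^ 3 / 64 * (1/32) \<le> J"
      unfolding J_def by (rule mult_mono[OF If integral_test_g_ge order_trans[OF _ If]]) simp
    then have "r ^ 3 / 4096 \<le> \<bar>I - J\<bar>" using I by linarith
    also have "\<dots> \<le> N * C1_norm test_g * \<gamma> n"
      unfolding I_def J_def N_def by (rule assms(4)[OF C1_torus_test_f[OF r0] test_g_C1(1) n])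
    finally have main: "r ^ 3 / 4096 \<le> N * C1_norm test_g * \<gamma> n" .
    have N0: "0 \<le> N" unfolding N_def L1_nu_norm_def by (intro add_nonneg_nonneg nu_integral_nonneg) auto
    \<comment> \<open>Positivity of \<open>\<gamma> n\<close> is extracted first, because the factor
      in front of it is to be replaced by a larger one.\<close>
    have "0 < r ^ 3 / 4096" using r0 by simp
    then have "0 < N * C1_norm test_g * \<gamma> n" using main by linarith
    then have pos: "0 < \<gamma> n"
      using mult_nonneg_nonneg[OF N0 C1_norm_test_g(1)] by (simp add: zero_less_mult_iff)
    have "r\<^sup>2 \<le> r" using r0 r by (simp add: power2_eq_square mult_left_le_one_le)
    then have "N \<le> 8 * (17 + 32 * K) * r"
      using L1_nu_norm_deriv_along_test_f[OF r0 _ K(1) assms(3) K(2)] L1_nu_norm_test_f[OF r0] r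
      unfolding N_def by (simp add: algebra_simps)
    then have "N * C1_norm test_g \<le> 8 * (17 + 32 * K) * r * 9"
      using N0 C1_norm_test_g K(1) r0 by (intro mult_mono) auto
    then have "N * C1_norm test_g * \<gamma> n \<le> 8 * (17 + 32 * K) * r * 9 * \<gamma> n"
      using pos by (intro mult_right_mono) auto
    with main have "r ^ 3 / 4096 \<le> 8 * (17 + 32 * K) * r * 9 * \<gamma> n" by linarith
    then have "r * r\<^sup>2 \<le> r * (B * \<gamma> n)" by (simp add: B_def power3_eq_cube power2_eq_square algebra_simps)
    then have "r\<^sup>2 \<le> B * \<gamma> n" using r0 by simp
    then have "r\<^sup>2 / B \<le> \<gamma> n" using B by (simp add: divide_le_eq mult.commute)
    then show ?thesis by (simp add: r_def power_divide mult.commute)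
  qed
  then show ?thesis using c B by (intro exI[of _ "c\<^sup>2 / B"]) auto
qed

end
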